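(* The capacity region of the finite-alphabet cognitive MAC $P_{Y|X_1,X_2}$ with decoding metric $q(x_1,x_2,y)$ contains the closure of the convex hull of $\bigcup_P\tilde{\mathcal R}^{sup}_{cog}(P)$, the union being over all distributions $P$ on $\mathcal X_1\times\mathcal X_2\times\mathcal Y$ of the form $P=P_{X_1,X_2}P_{Y|X_1,X_2}$ with $P_{Y|X_1,X_2}$ the channel, where $$\tilde{\mathcal R}^{sup}_{cog}(P)=\Big\{(R_1,R_2):\ R_2\le\min_{\tilde P\in\mathcal L_2(P)}I_{\tilde P}(X_2;Y|X_1),\ R_1+R_2\le\min_{\tilde P\in\mathcal L_0(P):\,I_{\tilde P}(X_1;Y)\le R_1}I_{\tilde P}(X_1,X_2;Y)\Big\}.$$
   Context: Cognitive MAC with mismatched decoding: finite alphabets $\mathcal X_1,\mathcal X_2,\mathcal Y$, memoryless channel $P_{Y|X_1,X_2}$, metric $q$. A blocklength-$n$ code of rates $(R_1,R_2)$ has encoder 1 mapping $W_1\in\{1,\dots,2^{nR_1}\}$ to $\mathbf x_1(W_1)\in\mathcal X_1^n$ and encoder 2 mapping $(W_1,W_2)$, $W_2\in\{1,\dots,2^{nR_2}\}$, to $\mathbf x_2(W_1,W_2)\in\mathcal X_2^n$; messages are uniform. The decoder outputs $(i,j)$ iff $\sum_t q(x_{1,t}(i),x_{2,t}(i,j),y_t)>\sum_t q(x_{1,t}(i'),x_{2,t}(i',j'),y_t)$ for all $(i',j')\neq(i,j)$, else error. A rate pair is achievable if there are codes with average error probability tending to zero; the capacity region is the closure of the set of achievable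 pairs. For a distribution $Q$: $\mathcal G_q(Q)=\{f: f_{X_1,X_2}=Q_{X_1,X_2},\ \mathbb E_f q\ge\mathbb E_Q q\}$; $\mathcal L_2(Q)=\{f\in\mathcal G_q(Q):f_{X_1,Y}=Q_{X_1,Y}\}$; $\mathcal L_0(Q)=\{f\in\mathcal G_q(Q):f_Y=Q_Y\}$. *)

theory Defs
  imports "HOL-Analysis.Analysis"
begin

text \<open>Finite alphabets are finite types 'a (X1), 'b (X2), 'c (Y).
  Joint distributions on X1 x X2 x Y are functions f :: 'a => 'b => 'c => real.
  Logarithms are base 2 (rates in bits, matching 2^(nR) messages).\<close>

definition is_channel :: "('a::finite \<Rightarrow> 'b::finite \<Rightarrow> 'c::finite \<Rightarrow> real) \<Rightarrow> bool" where
  "is_channel W \<longleftrightarrow> (\<forall>a b c. 0 \<le> W a b c) \<and> (\<forall>a b. (\<Sum>c\<in>UNIV. W a b c) = 1)"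

definition is_dist3 :: "('a::finite \<Rightarrow> 'b::finite \<Rightarrow> 'c::finite \<Rightarrow> real) \<Rightarrow> bool" where
  "is_dist3 f \<longleftrightarrow> (\<forall>a b c. 0 \<le> f a b c) \<and> (\<Sum>a\<in>UNIV. \<Sum>b\<in>UNIV. \<Sum>c\<in>UNIV. f a b c) = 1"

definition is_dist2 :: "('a::finite \<Rightarrow> 'b::finite \<Rightarrow> real) \<Rightarrow> bool" where
  "is_dist2 p \<longleftrightarrow> (\<forall>a b. 0 \<le> p a b) \<and> (\<Sum>a\<in>UNIV. \<Sum>b\<in>UNIV. p a b) = 1"

definition marg12 :: "('a::finite \<Rightarrow> 'b::finite \<Rightarrow> 'c::finite \<Rightarrow> real) \<Rightarrow> 'a \<Rightarrow> 'b \<Rightarrow> real" where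
  "marg12 f a b = (\<Sum>c\<in>UNIV. f a b c)"
definition marg1Y :: "('a::finite \<Rightarrow> 'b::finite \<Rightarrow> 'c::finite \<Rightarrow> real) \<Rightarrow> 'a \<Rightarrow> 'c \<Rightarrow> real" where
  "marg1Y f a c = (\<Sum>b\<in>UNIV. f a b c)"
definition marg1 :: "('a::finite \<Rightarrow> 'b::finite \<Rightarrow> 'c::finite \<Rightarrow> real) \<Rightarrow> 'a \<Rightarrow> real" where
  "marg1 f a = (\<Sum>b\<in>UNIV. \<Sum>c\<in>UNIV. f a b c)"
definition margY :: "('a::finite \<Rightarrow> 'b::finite \<Rightarrow> 'c::finite \<Rightarrow> real) \<Rightarrow> 'c \<Rightarrow> real" where
  "margY f c = (\<Sum>a\<in>UNIV. \<Sum>b\<in>UNIV. f a b c)"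

definition plog :: "real \<Rightarrow> real \<Rightarrow> real" where
  "plog p r = (if p = 0 then 0 else p * log 2 (p / r))"

definition MI_X2_Y_given_X1 :: "('a::finite \<Rightarrow> 'b::finite \<Rightarrow> 'c::finite \<Rightarrow> real) \<Rightarrow> real" where
  "MI_X2_Y_given_X1 f = (\<Sum>a\<in>UNIV. \<Sum>b\<in>UNIV. \<Sum>c\<in>UNIV.
      plog (f a b c) (marg12 f a b * marg1Y f a c / marg1 f a))"

definition MI_X1_Y :: "('a::finite \<Rightarrow> 'b::finite \<Rightarrow> 'c::finite \<Rightarrow> real) \<Rightarrow> real" where
  "MI_X1_Y f = (\<Sum>a\<in>UNIV. \<Sum>c\<in>UNIV. plog (marg1Y f a c) (marg1 f a * margY f c))"

definition MI_X1X2_Y :: "('a::finite \<Rightarrow> 'b::finite \<Rightarrow> 'c::finite \<Rightarrow> real) \<Rightarrow> real" where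
  "MI_X1X2_Y f = (\<Sum>a\<in>UNIV. \<Sum>b\<in>UNIV. \<Sum>c\<in>UNIV. plog (f a b c) (marg12 f a b * margY f c))"

definition expect_q :: "('a::finite \<Rightarrow> 'b::finite \<Rightarrow> 'c::finite \<Rightarrow> real) \<Rightarrow> ('a \<Rightarrow> 'b \<Rightarrow> 'c \<Rightarrow> real) \<Rightarrow> real" where
  "expect_q f q = (\<Sum>a\<in>UNIV. \<Sum>b\<in>UNIV. \<Sum>c\<in>UNIV. f a b c * q a b c)"

definition G_q :: "('a::finite \<Rightarrow> 'b::finite \<Rightarrow> 'c::finite \<Rightarrow> real) \<Rightarrow> ('a \<Rightarrow> 'b \<Rightarrow> 'c \<Rightarrow> real)
     \<Rightarrow> ('a \<Rightarrow> 'b \<Rightarrow> 'c \<Rightarrow> real) set" where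
  "G_q q Q = {f. is_dist3 f \<and> marg12 f = marg12 Q \<and> expect_q f q \<ge> expect_q Q q}"

definition L2 :: "('a::finite \<Rightarrow> 'b::finite \<Rightarrow> 'c::finite \<Rightarrow> real) \<Rightarrow> ('a \<Rightarrow> 'b \<Rightarrow> 'c \<Rightarrow> real)
     \<Rightarrow> ('a \<Rightarrow> 'b \<Rightarrow> 'c \<Rightarrow> real) set" where
  "L2 q Q = {f \<in> G_q q Q. marg1Y f = marg1Y Q}"

definition L0 :: "('a::finite \<Rightarrow> 'b::finite \<Rightarrow> 'c::finite \<Rightarrow> real) \<Rightarrow> ('a \<Rightarrow> 'b \<Rightarrow> 'c \<Rightarrow> real)
     \<Rightarrow> ('a \<Rightarrow> 'b \<Rightarrow> 'c \<Rightarrow> real) set" where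
  "L0 q Q = {f \<in> G_q q Q. margY f = margY Q}"

text \<open>The region tilde R^sup_cog(P). "R \<le> min S" is written as "R \<le> every element of S"
  (min over an empty set = +infinity). Rate pairs are nonnegative.\<close>
definition R_cog_sup :: "('a::finite \<Rightarrow> 'b::finite \<Rightarrow> 'c::finite \<Rightarrow> real) \<Rightarrow> ('a \<Rightarrow> 'b \<Rightarrow> 'c \<Rightarrow> real)
     \<Rightarrow> (real \<times> real) set" where
  "R_cog_sup q P = {(R1, R2). 0 \<le> R1 \<and> 0 \<le> R2 \<and>
      (\<forall>f\<in>L2 q P. R2 \<le> MI_X2_Y_given_X1 f) \<and>
      (\<forall>f\<in>L0 q P. MI_X1_Y f \<le> R1 \<longrightarrow> R1 + R2 \<le> MI_X1X2_Y f)}"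

definition induced_dists :: "('a::finite \<Rightarrow> 'b::finite \<Rightarrow> 'c::finite \<Rightarrow> real)
     \<Rightarrow> ('a \<Rightarrow> 'b \<Rightarrow> 'c \<Rightarrow> real) set" where
  "induced_dists W = {(\<lambda>a b c. p a b * W a b c) | p. is_dist2 p}"

text \<open>Codes. Messages are 0-based: W1 in {..<M1}, W2 in {..<M2}; time indices t in {..<n}.
  x1 i t is the t-th symbol of codeword of message i; x2 i j t likewise.
  Output sequences are the extensional functions on {..<n}, i.e. PiE {..<n} (%_. UNIV).\<close>
definition metric_score :: "('a \<Rightarrow> 'b \<Rightarrow> 'c \<Rightarrow> real) \<Rightarrow> nat \<Rightarrow> (nat \<Rightarrow> nat \<Rightarrow> 'a)
    \<Rightarrow> (nat \<Rightarrow> nat \<Rightarrow> nat \<Rightarrow> 'b) \<Rightarrow> nat \<Rightarrow> nat \<Rightarrow> (nat \<Rightarrow> 'c) \<Rightarrow> real" where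
  "metric_score q n x1 x2 i j y = (\<Sum>t<n. q (x1 i t) (x2 i j t) (y t))"

definition decodes_correctly :: "('a \<Rightarrow> 'b \<Rightarrow> 'c \<Rightarrow> real) \<Rightarrow> nat \<Rightarrow> nat \<Rightarrow> nat \<Rightarrow> (nat \<Rightarrow> nat \<Rightarrow> 'a)
    \<Rightarrow> (nat \<Rightarrow> nat \<Rightarrow> nat \<Rightarrow> 'b) \<Rightarrow> nat \<Rightarrow> nat \<Rightarrow> (nat \<Rightarrow> 'c) \<Rightarrow> bool" where
  "decodes_correctly q n M1 M2 x1 x2 i j y \<longleftrightarrow>
     (\<forall>i'<M1. \<forall>j'<M2. (i', j') \<noteq> (i, j) \<longrightarrow>
        metric_score q n x1 x2 i j y > metric_score q n x1 x2 i' j' y)"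

definition avg_error :: "('a::finite \<Rightarrow> 'b::finite \<Rightarrow> 'c::finite \<Rightarrow> real) \<Rightarrow> ('a \<Rightarrow> 'b \<Rightarrow> 'c \<Rightarrow> real)
    \<Rightarrow> nat \<Rightarrow> nat \<Rightarrow> nat \<Rightarrow> (nat \<Rightarrow> nat \<Rightarrow> 'a) \<Rightarrow> (nat \<Rightarrow> nat \<Rightarrow> nat \<Rightarrow> 'b) \<Rightarrow> real" where
  "avg_error W q n M1 M2 x1 x2 =
     (1 / (real M1 * real M2)) * (\<Sum>i<M1. \<Sum>j<M2.
        \<Sum>y\<in>({..<n} \<rightarrow>\<^sub>E UNIV). if decodes_correctly q n M1 M2 x1 x2 i j y then 0
                              else (\<Prod>t<n. W (x1 i t) (x2 i j t) (y t)))"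

definition num_msgs :: "nat \<Rightarrow> real \<Rightarrow> nat" where
  "num_msgs n R = nat \<lceil>2 powr (real n * R)\<rceil>"

definition achievable :: "('a::finite \<Rightarrow> 'b::finite \<Rightarrow> 'c::finite \<Rightarrow> real) \<Rightarrow> ('a \<Rightarrow> 'b \<Rightarrow> 'c \<Rightarrow> real)
    \<Rightarrow> real \<times> real \<Rightarrow> bool" where
  "achievable W q R \<longleftrightarrow> 0 \<le> fst R \<and> 0 \<le> snd R \<and>
     (\<forall>\<epsilon>>0. \<exists>N. \<forall>n\<ge>N. \<exists>(x1 :: nat \<Rightarrow> nat \<Rightarrow> 'a) (x2 :: nat \<Rightarrow> nat \<Rightarrow> nat \<Rightarrow> 'b).
        avg_error W q n (num_msgs n (fst R)) (num_msgs n (snd R)) x1 x2 \<le> \<epsilon>)"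

definition capacity_region :: "('a::finite \<Rightarrow> 'b::finite \<Rightarrow> 'c::finite \<Rightarrow> real) \<Rightarrow> ('a \<Rightarrow> 'b \<Rightarrow> 'c \<Rightarrow> real)
    \<Rightarrow> (real \<times> real) set" where
  "capacity_region W q = closure {R. achievable W q R}"

end

theory Submission
  imports Defs "HOL-Probability.Probability" "HOL-Real_Asymp.Real_Asymp"
begin

text \<open>Random superposition coding. The cloud centres are drawn i.i.d. from \<open>P_X1\<close> and the satellites
  from \<open>P_X2|X1\<close>, both conditioned on being typical, which costs only a bounded factor compared to
  i.i.d. codewords. Fix a typical transmitted triple. A competing satellite of the same cloud wins
  only if its joint type \<open>f\<close> with the cloud centre and the output is close to \<open>L2(P)\<close>, which has
  probability at most \<open>2 powr (- n * I_f(X2;Y|X1))\<close> up to constants. A competing cloud wins only with a type \<open>f\<close> close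
  to \<open>L0(P)\<close>; this has probability at most \<open>2 powr (- n * I_f(X1;Y))\<close>, since the centre alone must fit
  the output, and also at most \<open>2 powr (n * R2 - n * I_f(X1,X2;Y))\<close> by the union bound over the cloud.
  The first bound beats the \<open>2 powr (n * R1)\<close> clouds if \<open>I_f(X1;Y) > R1\<close> and the second one otherwise.
  Compactness of the simplex transfers the conditions on \<open>L0(P)\<close> and \<open>L2(P)\<close> to types that are only
  close to them, there are polynomially many types, and time sharing gives the convex hull.\<close>

section \<open>Probability mass functions\<close>

text \<open>The obstacle is that \<open>G_q\<close> pins the pair marginal of every competing law to
  that of \<open>P\<close>, whereas i.i.d. codewords now and then have quite different pair types
  and could then win with a type that neither \<open>L2\<close> nor \<open>L0\<close> controls.
  Conditioning excludes such codewords; since the typical sets have probability at least 1/2, the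
  conditioned laws remain dominated by product measures, and all exponents can be computed for the
  latter. Codewords of exact composition are no substitute, because the entries of \<open>P\<close>
  need not be multiples of \<open>1 / n\<close>. Hence every constraint carries a tolerance \<eta>,
  fixed before \<open>n\<close> is chosen. The side condition \<open>MI_X1_Y f \<le> R1\<close> of
  the region is the trace of taking, for each single type, the better of the two bounds for a
  competing cloud. Ties are decoding errors, so a competitor is counted as soon as its score is
  \<open>\<ge>\<close> the true one. Both rates are lowered by a small amount, which the closure in
  \<open>capacity_region\<close> restores.\<close>

lemma measure_bind_pmf_expectation:
  "measure_pmf.prob (bind_pmf p f) A = measure_pmf.expectation p (\<lambda>x. measure_pmf.prob (f x) A)"
proof -
  have int: "integrable (measure_pmf p) (\<lambda>x. measure_pmf.prob (f x) A)"
    by (rule measure_pmf.integrable_const_bound[where B = 1]) auto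
  have "ennreal (measure_pmf.prob (bind_pmf p f) A)
      = (\<integral>\<^sup>+x. ennreal (measure_pmf.prob (f x) A) \<partial>measure_pmf p)"
    by (simp add: measure_pmf.emeasure_eq_measure[symmetric])
  also have "\<dots> = ennreal (measure_pmf.expectation p (\<lambda>x. measure_pmf.prob (f x) A))"
    by (rule nn_integral_eq_integral[OF int]) auto
  finally show ?thesis
    by (simp add: integral_nonneg_AE)
qed

lemma prob_bind_pmf_le:
  assumes "\<And>x. x \<in> set_pmf p \<Longrightarrow> measure_pmf.prob (f x) A \<le> c"
  shows "measure_pmf.prob (bind_pmf p f) A \<le> c"
proof -
  have "measure_pmf.expectation p (\<lambda>x. measure_pmf.prob (f x) A) \<le> c"
    by (rule measure_pmf.integral_le_const)
       (auto intro!: measure_pmf.integrable_const_bound[where B = 1] AE_pmfI assms)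
  then show ?thesis by (simp add: measure_bind_pmf_expectation)
qed

lemma prob_le_of_pmf_le:
  assumes "\<And>x. x \<in> A \<Longrightarrow> pmf p x \<le> c * pmf q x" "0 \<le> c"
  shows "measure_pmf.prob p A \<le> c * measure_pmf.prob q A"
proof -
  have "emeasure (measure_pmf p) A \<le> (\<integral>\<^sup>+x. ennreal c * ennreal (pmf q x) \<partial>count_space A)"
    unfolding nn_integral_pmf[symmetric]
    by (intro nn_integral_mono) (use assms in \<open>simp add: ennreal_mult[symmetric]\<close>)
  also have "\<dots> = ennreal (c * measure_pmf.prob q A)"
    using assms by (simp add: nn_integral_cmult nn_integral_pmf measure_pmf.emeasure_eq_measure ennreal_mult)
  finally show ?thesis
    using assms by (simp add: measure_pmf.emeasure_eq_measure)
qed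

text \<open>Domination of mass functions survives composition of kernels, with the constants
  multiplied. The kernels are compared only on the support of \<open>p\<close>, since a satellite
  law will be controlled only when its centre is typical.\<close>

lemma pmf_bind_le_of_pmf_le:
  assumes p: "\<And>x. pmf p x \<le> c * pmf q x" "0 \<le> c"
    and f: "\<And>x. x \<in> set_pmf p \<Longrightarrow> pmf (f x) y \<le> d * pmf (g x) y" "0 \<le> d"
  shows "pmf (bind_pmf p f) y \<le> c * d * pmf (bind_pmf q g) y"
proof -
  have "ennreal (pmf (bind_pmf p f) y) = (\<integral>\<^sup>+x. ennreal (pmf p x) * ennreal (pmf (f x) y) \<partial>count_space UNIV)"
    by (simp add: ennreal_pmf_bind nn_integral_measure_pmf)
  also have "\<dots> \<le> (\<integral>\<^sup>+x. ennreal (c * d) * (ennreal (pmf q x) * ennreal (pmf (g x) y)) \<partial>count_space UNIV)"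
  proof (intro nn_integral_mono)
    fix x
    have "pmf p x * pmf (f x) y \<le> (c * pmf q x) * (d * pmf (g x) y)"
    proof (cases "x \<in> set_pmf p")
      case True
      then show ?thesis using p f by (intro mult_mono) auto
    next
      case False
      then show ?thesis using p f by (simp add: set_pmf_iff)
    qed
    then show "ennreal (pmf p x) * ennreal (pmf (f x) y) \<le> ennreal (c * d) * (ennreal (pmf q x) * ennreal (pmf (g x) y))"
      using p f by (simp add: ennreal_mult[symmetric] mult_ac)
  qed
  also have "\<dots> = ennreal (c * d) * ennreal (pmf (bind_pmf q g) y)"
    by (simp add: ennreal_pmf_bind nn_integral_measure_pmf nn_integral_cmult)
  also have "\<dots> = ennreal (c * d * pmf (bind_pmf q g) y)"
    using p f by (simp add: ennreal_mult)
  finally show ?thesis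
    using p f by simp
qed

text \<open>Conditioning divides by a probability of at least 1/2; the factors 2 that separate the
  conditioned ensemble from the i.i.d. one originate here.\<close>

lemma pmf_cond_le:
  assumes "measure_pmf.prob q s \<ge> 1 / 2"
  shows "pmf (cond_pmf q s) x \<le> 2 * pmf q x"
proof -
  have "set_pmf q \<inter> s \<noteq> {}"
    using assms measure_pmf_zero_iff[of q s] by auto
  moreover have "pmf q x / measure_pmf.prob q s \<le> pmf q x / (1 / 2)"
    using assms by (intro divide_left_mono) auto
  ultimately show ?thesis
    using assms by (auto simp: pmf_cond)
qed

lemma set_cond_pmf_of_prob:
  assumes "measure_pmf.prob q s \<ge> 1 / 2"
  shows "set_pmf (cond_pmf q s) = set_pmf q \<inter> s"
  using assms measure_pmf_zero_iff[of q s] by (intro set_cond_pmf) auto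

text \<open>Pairwise independence suffices for the code: the union bound looks at the transmitted
  entry and one competing entry at a time.\<close>

lemma Pi_pmf_two_components:
  assumes "finite A" "i \<in> A" "j \<in> A" "i \<noteq> j"
  shows "map_pmf (\<lambda>f. (f i, f j)) (Pi_pmf A d p) = pair_pmf (p i) (p j)"
proof -
  have "map_pmf (\<lambda>f. (f i, f j)) (Pi_pmf (insert i (A - {i})) d p)
      = map_pmf (apsnd (\<lambda>f. f j)) (pair_pmf (p i) (Pi_pmf (A - {i}) d p))"
    using assms by (subst Pi_pmf_insert) (auto simp: map_pmf_comp intro!: map_pmf_cong)
  also have "\<dots> = pair_pmf (p i) (p j)"
    using assms by (simp add: pair_map_pmf2[symmetric] Pi_pmf_component)
  finally show ?thesis using assms by (simp add: insert_absorb)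
qed

section \<open>Random codes\<close>

text \<open>Centre and satellites are drawn together, so that a code is a product of independent
  clouds although satellites of one cloud are independent only given their centre.\<close>

definition cloud_pmf :: "'u pmf \<Rightarrow> ('u \<Rightarrow> 'v pmf) \<Rightarrow> nat \<Rightarrow> ('u \<times> (nat \<Rightarrow> 'v)) pmf" where
  "cloud_pmf p1 p2 M = bind_pmf p1 (\<lambda>u. map_pmf (Pair u) (Pi_pmf {..<M} undefined (\<lambda>_. p2 u)))"

lemma map_cloud_component:
  assumes "j < M"
  shows "map_pmf (\<lambda>c. (fst c, snd c j)) (cloud_pmf p1 p2 M)
    = bind_pmf p1 (\<lambda>u. map_pmf (Pair u) (p2 u))"
proof -
  have "map_pmf (\<lambda>V. (u, V j)) (Pi_pmf {..<M} undefined (\<lambda>_. p2 u)) = map_pmf (Pair u) (p2 u)" for u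
    using assms Pi_pmf_component[of "{..<M}" j undefined "\<lambda>_. p2 u"]
    by (simp add: map_pmf_comp[of "Pair u" "\<lambda>V. V j", symmetric])
  then show ?thesis
    by (simp add: cloud_pmf_def map_bind_pmf map_pmf_comp)
qed

lemma map_cloud_two_components:
  assumes "j < M" "j' < M" "j \<noteq> j'"
  shows "map_pmf (\<lambda>c. (fst c, snd c j, snd c j')) (cloud_pmf p1 p2 M)
    = bind_pmf p1 (\<lambda>u. map_pmf (Pair u) (pair_pmf (p2 u) (p2 u)))"
proof -
  have "map_pmf (\<lambda>V. (u, V j, V j')) (Pi_pmf {..<M} undefined (\<lambda>_. p2 u))
      = map_pmf (Pair u) (pair_pmf (p2 u) (p2 u))" for u
    using assms Pi_pmf_two_components[of "{..<M}" j j' undefined "\<lambda>_. p2 u"]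
    by (simp add: map_pmf_comp[of "Pair u" "\<lambda>V. (V j, V j')", symmetric])
  then show ?thesis
    by (simp add: cloud_pmf_def map_bind_pmf map_pmf_comp)
qed

lemma set_cloud_pmf:
  assumes "c \<in> set_pmf (cloud_pmf p1 p2 M)" "j < M"
  shows "fst c \<in> set_pmf p1" "snd c j \<in> set_pmf (p2 (fst c))"
  using assms by (auto simp: cloud_pmf_def set_Pi_pmf PiE_dflt_def)

text \<open>The reorderings below draw the competing codeword after the channel output, so that its
  probability can be bounded for a fixed output.\<close>

lemma random_code_error:
  fixes p1 :: "'u pmf" and p2 :: "'u \<Rightarrow> 'v pmf" and N :: "'u \<Rightarrow> 'v \<Rightarrow> 'w pmf"
    and S :: "'u \<Rightarrow> 'v \<Rightarrow> 'w \<Rightarrow> real" and Typ :: "'u \<Rightarrow> 'v \<Rightarrow> 'w \<Rightarrow> bool"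
    and M1 M2 :: nat
  defines "code \<equiv> Pi_pmf {..<M1} undefined (\<lambda>_. cloud_pmf p1 p2 M2)"
  assumes i: "i < M1" and j: "j < M2" and e: "0 \<le> e"
    and atyp: "measure_pmf.prob
        (bind_pmf p1 (\<lambda>u. bind_pmf (p2 u) (\<lambda>v. map_pmf (\<lambda>w. (u, v, w)) (N u v))))
        {(u, v, w). \<not> Typ u v w} \<le> e"
    and same_cloud: "\<And>u v w. u \<in> set_pmf p1 \<Longrightarrow> v \<in> set_pmf (p2 u) \<Longrightarrow> Typ u v w \<Longrightarrow>
        real (M2 - 1) * measure_pmf.prob (p2 u) {v'. S u v' w \<ge> S u v w} \<le> e"
    and other_cloud: "\<And>u v w. u \<in> set_pmf p1 \<Longrightarrow> v \<in> set_pmf (p2 u) \<Longrightarrow> Typ u v w \<Longrightarrow>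
        real (M1 - 1) * measure_pmf.prob (cloud_pmf p1 p2 M2)
          {(u', V). \<exists>j'<M2. S u' (V j') w \<ge> S u v w} \<le> e"
  shows "measure_pmf.expectation code (\<lambda>C. measure_pmf.prob (N (fst (C i)) (snd (C i) j))
      {w. \<exists>i'<M1. \<exists>j'<M2. (i', j') \<noteq> (i, j) \<and>
        S (fst (C i')) (snd (C i') j') w \<ge> S (fst (C i)) (snd (C i) j) w}) \<le> 3 * e"
proof -
  \<comment> \<open>Joint law of code and output for the fixed message pair; it turns the expected
    error into the probability of a single event.\<close>
  define J where "J = bind_pmf code (\<lambda>C. map_pmf (Pair C) (N (fst (C i)) (snd (C i) j)))"
  define A0 where "A0 = {(C, w). \<not> Typ (fst (C i)) (snd (C i) j) w}"
  \<comment> \<open>The competitor events include typicality, so that the hypotheses apply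
    pointwise. A competing cloud is one object in \<open>A1\<close>, because its satellites share a
    centre.\<close>
  define A2 where "A2 j' = {(C, w). Typ (fst (C i)) (snd (C i) j) w \<and>
      S (fst (C i)) (snd (C i) j') w \<ge> S (fst (C i)) (snd (C i) j) w}" for j'
  define A1 where "A1 i' = {(C, w). Typ (fst (C i)) (snd (C i) j) w \<and>
      (\<exists>j'<M2. S (fst (C i')) (snd (C i') j') w \<ge> S (fst (C i)) (snd (C i) j) w)}" for i'
  define Err where "Err = {(C, w). \<exists>i'<M1. \<exists>j'<M2. (i', j') \<noteq> (i, j) \<and>
        S (fst (C i')) (snd (C i') j') w \<ge> S (fst (C i)) (snd (C i) j) w}"
  have comp: "map_pmf (\<lambda>C. C i) code = cloud_pmf p1 p2 M2"
    using i by (simp add: code_def Pi_pmf_component)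
  have exp: "measure_pmf.prob J Err = measure_pmf.expectation code
      (\<lambda>C. measure_pmf.prob (N (fst (C i)) (snd (C i) j))
      {w. \<exists>i'<M1. \<exists>j'<M2. (i', j') \<noteq> (i, j) \<and>
        S (fst (C i')) (snd (C i') j') w \<ge> S (fst (C i)) (snd (C i) j) w})"
    by (simp add: J_def Err_def measure_bind_pmf_expectation vimage_def)
  have P0: "measure_pmf.prob J A0 \<le> e"
  proof -
    let ?h = "\<lambda>(u, v). map_pmf (\<lambda>w. (u, v, w)) (N u v)"
    have "map_pmf (\<lambda>(C, w). (fst (C i), snd (C i) j, w)) J
        = bind_pmf (map_pmf (\<lambda>c. (fst c, snd c j)) (map_pmf (\<lambda>C. C i) code)) ?h"
      by (simp add: J_def map_bind_pmf map_pmf_comp bind_map_pmf)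
    also have "\<dots> = bind_pmf p1 (\<lambda>u. bind_pmf (p2 u) (\<lambda>v. map_pmf (\<lambda>w. (u, v, w)) (N u v)))"
      unfolding comp map_cloud_component[OF j] by (simp add: bind_assoc_pmf bind_map_pmf)
    finally have "measure_pmf.prob (map_pmf (\<lambda>(C, w). (fst (C i), snd (C i) j, w)) J)
        {(u, v, w). \<not> Typ u v w} \<le> e"
      using atyp by simp
    moreover have "(\<lambda>(C, w). (fst (C i), snd (C i) j, w)) -` {(u, v, w). \<not> Typ u v w} = A0"
      by (auto simp: A0_def)
    ultimately show ?thesis by simp
  qed
  have P2: "measure_pmf.prob J (A2 j') \<le> e / real (M2 - 1)" if j': "j' < M2" "j' \<noteq> j" for j'
  proof -
    let ?B = "{(u, v, v', w). Typ u v w \<and> S u v' w \<ge> S u v w}"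
    let ?h = "\<lambda>(u, v, v'). map_pmf (\<lambda>w. (u, v, v', w)) (N u v)"
    have "map_pmf (\<lambda>(C, w). (fst (C i), snd (C i) j, snd (C i) j', w)) J
        = bind_pmf (map_pmf (\<lambda>c. (fst c, snd c j, snd c j')) (map_pmf (\<lambda>C. C i) code)) ?h"
      by (simp add: J_def map_bind_pmf map_pmf_comp bind_map_pmf)
    also have "\<dots> = bind_pmf p1 (\<lambda>u. bind_pmf (p2 u) (\<lambda>v. bind_pmf (p2 u) (\<lambda>v'.
        bind_pmf (N u v) (\<lambda>w. return_pmf (u, v, v', w)))))"
      unfolding comp map_cloud_two_components[OF j j'(1) j'(2)[symmetric]]
      by (simp add: bind_assoc_pmf bind_map_pmf pair_pmf_def bind_return_pmf map_pmf_def)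
    also have "\<dots> = bind_pmf p1 (\<lambda>u. bind_pmf (p2 u) (\<lambda>v. bind_pmf (N u v) (\<lambda>w.
        map_pmf (\<lambda>v'. (u, v, v', w)) (p2 u))))"
      unfolding map_pmf_def by (subst (3) bind_commute_pmf) (rule refl)
    finally have eq: "map_pmf (\<lambda>(C, w). (fst (C i), snd (C i) j, snd (C i) j', w)) J = \<dots>" .
    have "measure_pmf.prob (map_pmf (\<lambda>(C, w). (fst (C i), snd (C i) j, snd (C i) j', w)) J) ?B
        \<le> e / real (M2 - 1)"
      unfolding eq
    proof (intro prob_bind_pmf_le)
      fix u v w
      assume uvw: "u \<in> set_pmf p1" "v \<in> set_pmf (p2 u)" "w \<in> set_pmf (N u v)"
      show "measure_pmf.prob (map_pmf (\<lambda>v'. (u, v, v', w)) (p2 u)) ?B \<le> e / real (M2 - 1)"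
      proof (cases "Typ u v w")
        case True
        \<comment> \<open>Two different indices below \<open>M2\<close> force
          \<open>M2 - 1 > 0\<close>, so the division is a genuine one.\<close>
        then show ?thesis
          using same_cloud[OF uvw(1,2) True] j' j by (simp add: field_simps vimage_def)
      next
        case False
        then show ?thesis using e by (simp add: vimage_def)
      qed
    qed
    moreover have "(\<lambda>(C, w). (fst (C i), snd (C i) j, snd (C i) j', w)) -` ?B = A2 j'"
      by (auto simp: A2_def)
    ultimately show ?thesis by simp
  qed
  have P1: "measure_pmf.prob J (A1 i') \<le> e / real (M1 - 1)" if i': "i' < M1" "i' \<noteq> i" for i'
  proof -
    let ?B = "{(c, c', w). Typ (fst c) (snd c j) w \<and>
      (\<exists>j'<M2. S (fst c') (snd c' j') w \<ge> S (fst c) (snd c j) w)}"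
    let ?h = "\<lambda>(c, c'). map_pmf (\<lambda>w. (c, c', w)) (N (fst c) (snd c j))"
    have "map_pmf (\<lambda>(C, w). (C i, C i', w)) J = bind_pmf (map_pmf (\<lambda>C. (C i, C i')) code) ?h"
      by (simp add: J_def map_bind_pmf map_pmf_comp bind_map_pmf)
    also have "\<dots> = bind_pmf (cloud_pmf p1 p2 M2) (\<lambda>c. bind_pmf (cloud_pmf p1 p2 M2) (\<lambda>c'.
        bind_pmf (N (fst c) (snd c j)) (\<lambda>w. return_pmf (c, c', w))))"
      unfolding code_def using i i'
      by (subst Pi_pmf_two_components)
         (simp_all add: bind_assoc_pmf pair_pmf_def bind_return_pmf map_pmf_def)
    also have "\<dots> = bind_pmf (cloud_pmf p1 p2 M2) (\<lambda>c. bind_pmf (N (fst c) (snd c j)) (\<lambda>w.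
        map_pmf (\<lambda>c'. (c, c', w)) (cloud_pmf p1 p2 M2)))"
      unfolding map_pmf_def by (subst (2) bind_commute_pmf) (rule refl)
    finally have eq: "map_pmf (\<lambda>(C, w). (C i, C i', w)) J = \<dots>" .
    have "measure_pmf.prob (map_pmf (\<lambda>(C, w). (C i, C i', w)) J) ?B \<le> e / real (M1 - 1)"
      unfolding eq
    proof (intro prob_bind_pmf_le)
      fix c w
      assume c: "c \<in> set_pmf (cloud_pmf p1 p2 M2)" and w: "w \<in> set_pmf (N (fst c) (snd c j))"
      show "measure_pmf.prob (map_pmf (\<lambda>c'. (c, c', w)) (cloud_pmf p1 p2 M2)) ?B \<le> e / real (M1 - 1)"
      proof (cases "Typ (fst c) (snd c j) w")
        case True
        have "(\<lambda>c'. (c, c', w)) -` ?B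
            = {(u', V). \<exists>j'<M2. S u' (V j') w \<ge> S (fst c) (snd c j) w}"
          using True by auto
        then show ?thesis
          using other_cloud[OF set_cloud_pmf[OF c j] True] i' i by (simp add: field_simps)
      next
        case False
        then show ?thesis using e by (simp add: vimage_def)
      qed
    qed
    moreover have "(\<lambda>(C, w). (C i, C i', w)) -` ?B = A1 i'"
      by (auto simp: A1_def)
    ultimately show ?thesis by simp
  qed
  let ?I1 = "{..<M1} - {i}" and ?I2 = "{..<M2} - {j}"
  have "Err \<subseteq> A0 \<union> (\<Union>j'\<in>?I2. A2 j') \<union> (\<Union>i'\<in>?I1. A1 i')"
    by (auto simp: Err_def A0_def A1_def A2_def)
  then have "measure_pmf.prob J Err \<le> measure_pmf.prob J (A0 \<union> (\<Union>j'\<in>?I2. A2 j') \<union> (\<Union>i'\<in>?I1. A1 i'))"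
    by (intro measure_pmf.finite_measure_mono) auto
  also have "\<dots> \<le> measure_pmf.prob J A0 + measure_pmf.prob J (\<Union>j'\<in>?I2. A2 j')
      + measure_pmf.prob J (\<Union>i'\<in>?I1. A1 i')"
    by (intro order_trans[OF measure_Un_le] add_mono order_refl) auto
  also have "\<dots> \<le> e + (\<Sum>j'\<in>?I2. e / real (M2 - 1)) + (\<Sum>i'\<in>?I1. e / real (M1 - 1))"
    by (intro add_mono P0 order_trans[OF measure_pmf.finite_measure_subadditive_finite] sum_mono P1 P2) auto
  \<comment> \<open>Each sum has as many terms as its denominator says, or is empty when only one
    index exists; hence an inequality.\<close>
  also have "\<dots> \<le> e + e + e"
    using i j e by (intro add_mono) auto
  finally show ?thesis using exp by simp
qed

text \<open>The expected average error is at most \<open>3 * e\<close>. The target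
  \<open>4 * e\<close> leaves a gap, so that a non-strict integral inequality already contradicts
  all codes being worse.\<close>

lemma random_code_exists:
  fixes p1 :: "'u pmf" and p2 :: "'u \<Rightarrow> 'v pmf" and N :: "'u \<Rightarrow> 'v \<Rightarrow> 'w pmf"
    and S :: "'u \<Rightarrow> 'v \<Rightarrow> 'w \<Rightarrow> real" and Typ :: "'u \<Rightarrow> 'v \<Rightarrow> 'w \<Rightarrow> bool"
    and M1 M2 :: nat
  assumes M: "0 < M1" "0 < M2" and e: "0 < e"
    and "measure_pmf.prob
        (bind_pmf p1 (\<lambda>u. bind_pmf (p2 u) (\<lambda>v. map_pmf (\<lambda>w. (u, v, w)) (N u v))))
        {(u, v, w). \<not> Typ u v w} \<le> e"
    and "\<And>u v w. u \<in> set_pmf p1 \<Longrightarrow> v \<in> set_pmf (p2 u) \<Longrightarrow> Typ u v w \<Longrightarrow>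
        real (M2 - 1) * measure_pmf.prob (p2 u) {v'. S u v' w \<ge> S u v w} \<le> e"
    and "\<And>u v w. u \<in> set_pmf p1 \<Longrightarrow> v \<in> set_pmf (p2 u) \<Longrightarrow> Typ u v w \<Longrightarrow>
        real (M1 - 1) * measure_pmf.prob (cloud_pmf p1 p2 M2)
          {(u', V). \<exists>j'<M2. S u' (V j') w \<ge> S u v w} \<le> e"
  shows "\<exists>x1 x2. 1 / (real M1 * real M2) * (\<Sum>i<M1. \<Sum>j<M2. measure_pmf.prob (N (x1 i) (x2 i j))
      {w. \<exists>i'<M1. \<exists>j'<M2. (i', j') \<noteq> (i, j) \<and> S (x1 i') (x2 i' j') w \<ge> S (x1 i) (x2 i j) w})
    \<le> 4 * e"
proof -
  define code where "code = Pi_pmf {..<M1} undefined (\<lambda>_. cloud_pmf p1 p2 M2)"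
  define err where "err i j C = measure_pmf.prob (N (fst (C i)) (snd (C i) j))
      {w. \<exists>i'<M1. \<exists>j'<M2. (i', j') \<noteq> (i, j) \<and>
        S (fst (C i')) (snd (C i') j') w \<ge> S (fst (C i)) (snd (C i) j) w}" for i j C
  have err: "measure_pmf.expectation code (err i j) \<le> 3 * e" if "i < M1" "j < M2" for i j
    unfolding err_def code_def
    by (rule random_code_error[where Typ = Typ]) (use assms that in auto)
  have int: "integrable (measure_pmf code) (err i j)" for i j
    by (rule measure_pmf.integrable_const_bound[where B = 1]) (auto simp: err_def)
  define tot where "tot C = 1 / (real M1 * real M2) * (\<Sum>i<M1. \<Sum>j<M2. err i j C)" for C
  have "measure_pmf.expectation code tot
      = 1 / (real M1 * real M2) * (\<Sum>i<M1. \<Sum>j<M2. measure_pmf.expectation code (err i j))"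
    unfolding tot_def by (simp add: int Bochner_Integration.integral_sum)
  also have "\<dots> \<le> 1 / (real M1 * real M2) * (\<Sum>i<M1. \<Sum>j<M2. 3 * e)"
    by (intro mult_left_mono sum_mono err) auto
  also have "\<dots> = 3 * e" using M by simp
  finally have le: "measure_pmf.expectation code tot \<le> 3 * e" .
  have "\<exists>C. tot C \<le> 4 * e"
  proof (rule ccontr)
    assume "\<not> ?thesis"
    moreover have "integrable (measure_pmf code) tot"
      unfolding tot_def by (intro integrable_mult_right Bochner_Integration.integrable_sum int)
    ultimately have "measure_pmf.expectation code tot \<ge> 4 * e"
      by (intro measure_pmf.integral_ge_const) (auto intro!: AE_pmfI less_imp_le simp: not_le)
    then show False using le e by simp
  qed
  then obtain C where "tot C \<le> 4 * e" ..
  then show ?thesis unfolding tot_def err_def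
    by (intro exI[of _ "\<lambda>i. fst (C i)"] exI[of _ "\<lambda>i. snd (C i)"]) simp
qed

section \<open>Joint types\<close>

lemma ex_pmf_of_fun:
  fixes g :: "'s::finite \<Rightarrow> real"
  assumes "\<And>x. 0 \<le> g x" "(\<Sum>x\<in>UNIV. g x) = 1"
  shows "\<exists>Q. \<forall>x. pmf Q x = g x"
proof -
  have "(\<integral>\<^sup>+x. g x \<partial>count_space UNIV) = 1"
    using assms by (simp add: nn_integral_count_space_finite sum_ennreal)
  then show ?thesis
    using assms pmf_embed_pmf[of g] by blast
qed

text \<open>The normalisation is multiplied out so that the zero function is covered as well, where
  any law serves. This yields conditional laws even given letters of mass zero.\<close>

lemma ex_pmf_proportional:
  fixes g :: "'s::finite \<Rightarrow> real"
  assumes "\<And>x. 0 \<le> g x"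
  shows "\<exists>Q. \<forall>x. (\<Sum>x\<in>UNIV. g x) * pmf Q x = g x"
proof (cases "(\<Sum>x\<in>UNIV. g x) = 0")
  case True
  then have "g x = 0" for x
    using assms by (simp add: sum_nonneg_eq_0_iff)
  then show ?thesis by simp
next
  case False
  then have pos: "(\<Sum>x\<in>UNIV. g x) > 0"
    using assms by (simp add: less_le sum_nonneg)
  have "\<exists>Q. \<forall>x. pmf Q x = g x / (\<Sum>x\<in>UNIV. g x)"
    using pos assms by (intro ex_pmf_of_fun) (simp_all add: sum_divide_distrib[symmetric])
  then obtain Q where "\<And>x. pmf Q x = g x / (\<Sum>x\<in>UNIV. g x)" by blast
  then have "(\<Sum>x\<in>UNIV. g x) * pmf Q x = g x" for x using pos by simp
  then show ?thesis by blast
qed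

definition etype2 :: "nat \<Rightarrow> (nat \<Rightarrow> 's) \<Rightarrow> (nat \<Rightarrow> 'w) \<Rightarrow> 's \<Rightarrow> 'w \<Rightarrow> real" where
  "etype2 n s w a c = real (card {t\<in>{..<n}. s t = a \<and> w t = c}) / real n"

text \<open>The empirical joint distribution, curried so that all marginals and informations apply
  to it directly. Only positions below \<open>n\<close> count.\<close>

definition etype :: "nat \<Rightarrow> (nat \<Rightarrow> 's) \<Rightarrow> (nat \<Rightarrow> 'v) \<Rightarrow> (nat \<Rightarrow> 'w) \<Rightarrow> 's \<Rightarrow> 'v \<Rightarrow> 'w \<Rightarrow> real" where
  "etype n s v w a b c = real (card {t\<in>{..<n}. s t = a \<and> v t = b \<and> w t = c}) / real n"

lemma etype2_sum: "etype2 n s w a c = (\<Sum>t<n. of_bool (s t = a \<and> w t = c)) / real n"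
  by (simp add: etype2_def sum.inter_filter[symmetric] of_bool_def)

lemma etype_sum: "etype n s v w a b c = (\<Sum>t<n. of_bool (s t = a \<and> v t = b \<and> w t = c)) / real n"
  by (simp add: etype_def sum.inter_filter[symmetric] of_bool_def)

lemma etype_nonneg: "0 \<le> etype n s v w a b c"
  by (simp add: etype_def)

lemma sum_UNIV_prod:
  "(\<Sum>x\<in>UNIV. h x) = (\<Sum>a\<in>(UNIV :: 'a::finite set). \<Sum>b\<in>(UNIV :: 'b::finite set). h (a, b))"
  by (simp add: sum.cartesian_product)

lemma sum_of_bool_conj:
  fixes x :: "'x::finite"
  shows "(\<Sum>y\<in>UNIV. of_bool (x = y \<and> P)) = (of_bool P :: real)"
    and "(\<Sum>y\<in>UNIV. of_bool (Q \<and> x = y \<and> P)) = (of_bool (Q \<and> P) :: real)"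
    and "(\<Sum>y\<in>UNIV. of_bool (Q \<and> P \<and> x = y)) = (of_bool (Q \<and> P) :: real)"
  by (cases P; cases Q; simp add: of_bool_def)+

lemma sum_of_bool_mult:
  fixes x :: "'x::finite" and h :: "'x \<Rightarrow> real"
  shows "(\<Sum>y\<in>UNIV. of_bool (P \<and> x = y) * h y) = of_bool P * h x"
    and "(\<Sum>y\<in>UNIV. of_bool (x = y) * h y) = h x"
proof -
  have "of_bool (P \<and> x = y) * h y = (if x = y then of_bool P * h y else 0)" for y by simp
  then show "(\<Sum>y\<in>UNIV. of_bool (P \<and> x = y) * h y) = of_bool P * h x"
    by (simp only: sum.delta' finite UNIV_I if_True)
  have "of_bool (x = y) * h y = (if x = y then h y else 0)" for y by simp
  then show "(\<Sum>y\<in>UNIV. of_bool (x = y) * h y) = h x"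
    by (simp only: sum.delta' finite UNIV_I if_True)
qed

lemma marg12_etype: "marg12 (etype n s v w) = etype2 n s v"
  unfolding marg12_def etype_sum etype2_sum fun_eq_iff
  by (subst sum_divide_distrib[symmetric], subst sum.swap) (simp add: sum_of_bool_conj)

lemma marg1Y_etype: "marg1Y (etype n s v w) = etype2 n s w"
  unfolding marg1Y_def etype_sum etype2_sum fun_eq_iff
  by (subst sum_divide_distrib[symmetric], subst sum.swap) (simp add: sum_of_bool_conj)

text \<open>An additive functional of three sequences depends on their joint type alone. This serves
  both the decoding score and the log-likelihood ratio of two product measures.\<close>

lemma sum_eq_etype:
  fixes s :: "nat \<Rightarrow> 's::finite" and v :: "nat \<Rightarrow> 'v::finite" and w :: "nat \<Rightarrow> 'w::finite"
  shows "(\<Sum>t<n. g (s t) (v t) (w t)) = real n * expect_q (etype n s v w) g"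
proof (cases "n = 0")
  case False
  have "real n * expect_q (etype n s v w) g
      = (\<Sum>a\<in>UNIV. \<Sum>b\<in>UNIV. \<Sum>c\<in>UNIV. \<Sum>t<n. of_bool (s t = a \<and> v t = b \<and> w t = c) * g a b c)"
    using False unfolding expect_q_def etype_sum sum_distrib_left times_divide_eq_left
    by (simp add: sum_distrib_right)
  also have "\<dots> = (\<Sum>t<n. \<Sum>a\<in>UNIV. \<Sum>b\<in>UNIV. \<Sum>c\<in>UNIV. of_bool (s t = a \<and> v t = b \<and> w t = c) * g a b c)"
    by (simp only: sum.swap[of _ "{..<n}" UNIV])
  also have "\<dots> = (\<Sum>t<n. g (s t) (v t) (w t))"
  proof (intro sum.cong refl)
    fix t
    show "(\<Sum>a\<in>UNIV. \<Sum>b\<in>UNIV. \<Sum>c\<in>UNIV. of_bool (s t = a \<and> v t = b \<and> w t = c) * g a b c)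
        = g (s t) (v t) (w t)"
      by (simp only: conj_assoc[symmetric] sum_of_bool_mult)
  qed
  finally show ?thesis by simp
qed simp

lemma is_dist3_etype:
  fixes s :: "nat \<Rightarrow> 's::finite" and v :: "nat \<Rightarrow> 'v::finite" and w :: "nat \<Rightarrow> 'w::finite"
  assumes "0 < n"
  shows "is_dist3 (etype n s v w)"
  using sum_eq_etype[of "\<lambda>_ _ _. 1" s v w n] assms
  by (auto simp: is_dist3_def etype_nonneg expect_q_def)

text \<open>A type is determined by one count in \<open>{..n}\<close> for each triple of
  letters.\<close>

lemma card_types_le:
  fixes n :: nat
  defines "T \<equiv> {f. \<exists>(s :: nat \<Rightarrow> 's::finite) (v :: nat \<Rightarrow> 'v::finite) (w :: nat \<Rightarrow> 'w::finite). f = etype n s v w}"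
  shows "finite T" "real (card T) \<le> real (n + 1) ^ CARD('s \<times> 'v \<times> 'w)"
proof -
  let ?K = "(UNIV :: ('s \<times> 'v \<times> 'w) set) \<rightarrow>\<^sub>E {..n}"
  let ?h = "\<lambda>k a b c. real (k (a, b, c)) / real n"
  have sub: "T \<subseteq> ?h ` ?K"
  proof
    fix f assume "f \<in> T"
    then obtain s :: "nat \<Rightarrow> 's" and v :: "nat \<Rightarrow> 'v" and w :: "nat \<Rightarrow> 'w" where f: "f = etype n s v w"
      unfolding T_def by blast
    have "card {t\<in>{..<n}. s t = a \<and> v t = b \<and> w t = c} \<le> n" for a b c
      using card_mono[of "{..<n}" "{t\<in>{..<n}. s t = a \<and> v t = b \<and> w t = c}"] by auto
    then show "f \<in> ?h ` ?K"
      by (intro image_eqI[of _ _ "\<lambda>(a, b, c). card {t\<in>{..<n}. s t = a \<and> v t = b \<and> w t = c}"])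
         (auto simp: f etype_def fun_eq_iff)
  qed
  have fin: "finite ?K" by (intro finite_PiE) auto
  show "finite T" using finite_subset[OF sub] fin by blast
  have "card T \<le> card ?K"
    using card_mono[OF _ sub] card_image_le[OF fin, of ?h] fin by fastforce
  also have "card ?K = (n + 1) ^ CARD('s \<times> 'v \<times> 'w)"
    by (simp add: card_PiE)
  finally show "real (card T) \<le> real (n + 1) ^ CARD('s \<times> 'v \<times> 'w)"
    by (metis of_nat_le_iff of_nat_power)
qed

text \<open>Maximum likelihood: no conditional law makes a sequence of type \<open>f\<close> more likely than the
  conditional law of \<open>f\<close> itself does (Gibbs), and given the output, the conditional law of \<open>f\<close>
  exceeds it by exactly the factor \<open>2 powr (n * I)\<close>.\<close>

lemma Gibbs_conditional:
  fixes f :: "'s::finite \<Rightarrow> 'v::finite \<Rightarrow> 'w::finite \<Rightarrow> real" and K :: "'s \<Rightarrow> 'v pmf"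
    and V :: "'s \<Rightarrow> 'w \<Rightarrow> 'v pmf"
  assumes f: "is_dist3 f"
    and V: "\<And>a b c. marg1Y f a c * pmf (V a c) b = f a b c"
    and K: "\<And>a b c. f a b c > 0 \<Longrightarrow> pmf (K a) b > 0"
  shows "ln 2 * MI_X2_Y_given_X1 f \<le> expect_q f (\<lambda>a b c. ln (pmf (V a c) b) - ln (pmf (K a) b))"
proof -
  have nn: "0 \<le> f a b c" for a b c using f by (simp add: is_dist3_def)
  have m12: "f a b c \<le> marg12 f a b" for a b c
    unfolding marg12_def using member_le_sum[of c UNIV "f a b"] nn by auto
  have m1Y: "f a b c \<le> marg1Y f a c" for a b c
    unfolding marg1Y_def using member_le_sum[of b UNIV "\<lambda>b. f a b c"] nn by auto
  have m1: "marg1 f a = (\<Sum>b\<in>UNIV. marg12 f a b)" for a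
    by (simp add: marg1_def marg12_def)
  have m12nn: "0 \<le> marg12 f a b" for a b
    unfolding marg12_def by (intro sum_nonneg) (auto simp: nn)
  have m1nn: "0 \<le> marg1 f a" for a
    unfolding m1 by (intro sum_nonneg) (auto simp: m12nn)
  have m1_12: "marg12 f a b \<le> marg1 f a" for a b
    unfolding m1 using member_le_sum[of b UNIV "marg12 f a"] m12nn by auto
  let ?r = "\<lambda>a b c. f a b c * (marg1 f a * pmf (K a) b / marg12 f a b)"
  \<comment> \<open>The difference of the two sides in the end is the conditional relative entropy
    between the law of the second letter given the first under \<open>f\<close> and
    \<open>K\<close>. Its nonnegativity is obtained through the correction \<open>f - ?r\<close>,
    whose total is nonnegative.\<close>
  have pt: "ln 2 * plog (f a b c) (marg12 f a b * marg1Y f a c / marg1 f a) + (f a b c - ?r a b c)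
      \<le> f a b c * (ln (pmf (V a c) b) - ln (pmf (K a) b))" for a b c
  proof (cases "f a b c = 0")
    case True
    then show ?thesis by (simp add: plog_def)
  next
    case False
    then have fp: "f a b c > 0" using nn[of a b c] by simp
    have p: "marg12 f a b > 0" "marg1Y f a c > 0" "marg1 f a > 0" "pmf (K a) b > 0"
      using fp m12[of a b c] m1Y[of a b c] m1_12[of a b] K[OF fp] by linarith+
    have Veq: "pmf (V a c) b = f a b c / marg1Y f a c"
      using V[of a c b] p by (simp add: field_simps)
    \<comment> \<open>The likelihood ratio of \<open>K\<close> against the conditional law of
      \<open>f\<close>; the tangent bound \<open>ln x \<le> x - 1\<close> is applied to it.\<close>
    define x where "x = marg1 f a * pmf (K a) b / marg12 f a b"
    have x: "x > 0" using p by (simp add: x_def)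
    have "ln (pmf (V a c) b) - ln (pmf (K a) b)
        = ln (f a b c / (marg12 f a b * marg1Y f a c / marg1 f a)) - ln x"
      using p fp by (simp add: x_def Veq ln_div ln_mult)
    moreover have "ln x \<le> x - 1" using x by (rule ln_le_minus_one)
    ultimately have "ln (f a b c / (marg12 f a b * marg1Y f a c / marg1 f a)) + (1 - x)
        \<le> ln (pmf (V a c) b) - ln (pmf (K a) b)" by simp
    then have "f a b c * (ln (f a b c / (marg12 f a b * marg1Y f a c / marg1 f a)) + (1 - x))
        \<le> f a b c * (ln (pmf (V a c) b) - ln (pmf (K a) b))"
      using fp by (intro mult_left_mono) auto
    then show ?thesis
      using fp by (simp add: plog_def log_def x_def[symmetric] algebra_simps)
  qed
  \<comment> \<open>Summing over \<open>c\<close> cancels \<open>marg12 f\<close> and leaves the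
    probability \<open>marg1 f a * pmf (K a) b\<close>. Cells with \<open>marg12 f a b = 0\<close>
    are lost, hence only an inequality.\<close>
  have "(\<Sum>a\<in>UNIV. \<Sum>b\<in>UNIV. \<Sum>c\<in>UNIV. ?r a b c) \<le> 1"
  proof -
    have "(\<Sum>c\<in>UNIV. ?r a b c) = marg12 f a b * (marg1 f a * pmf (K a) b / marg12 f a b)" for a b
      by (simp only: sum_distrib_right[symmetric] marg12_def)
    moreover have "marg12 f a b * (marg1 f a * pmf (K a) b / marg12 f a b) \<le> marg1 f a * pmf (K a) b" for a b
      using m1nn[of a] by (cases "marg12 f a b = 0") simp_all
    ultimately have "(\<Sum>a\<in>UNIV. \<Sum>b\<in>UNIV. \<Sum>c\<in>UNIV. ?r a b c) \<le> (\<Sum>a\<in>UNIV. \<Sum>b\<in>UNIV. marg1 f a * pmf (K a) b)"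
      by (intro sum_mono) (simp only:)
    also have "\<dots> = (\<Sum>a\<in>UNIV. marg1 f a)"
      by (simp add: sum_distrib_left[symmetric] sum_pmf_eq_1)
    also have "\<dots> = 1" using f by (simp add: marg1_def is_dist3_def)
    finally show ?thesis .
  qed
  then have "ln 2 * MI_X2_Y_given_X1 f \<le> ln 2 * MI_X2_Y_given_X1 f +
      ((\<Sum>a\<in>UNIV. \<Sum>b\<in>UNIV. \<Sum>c\<in>UNIV. f a b c) - (\<Sum>a\<in>UNIV. \<Sum>b\<in>UNIV. \<Sum>c\<in>UNIV. ?r a b c))"
    using f by (simp add: is_dist3_def)
  also have "\<dots> = (\<Sum>a\<in>UNIV. \<Sum>b\<in>UNIV. \<Sum>c\<in>UNIV.
      ln 2 * plog (f a b c) (marg12 f a b * marg1Y f a c / marg1 f a) + (f a b c - ?r a b c))"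
    by (simp add: MI_X2_Y_given_X1_def sum_distrib_left sum.distrib sum_subtractf)
  also have "\<dots> \<le> expect_q f (\<lambda>a b c. ln (pmf (V a c) b) - ln (pmf (K a) b))"
    unfolding expect_q_def by (intro sum_mono pt)
  finally show ?thesis .
qed

text \<open>Only this conditional form needs a direct proof: a one-letter alphabet for
  \<open>s\<close> removes the conditioning, and an alphabet of pairs for the random sequence gives
  the joint information.\<close>

lemma prob_type_le:
  fixes s :: "nat \<Rightarrow> 's::finite" and w :: "nat \<Rightarrow> 'w::finite" and K :: "'s \<Rightarrow> 'v::finite pmf"
  assumes n: "0 < n"
  shows "measure_pmf.prob (Pi_pmf {..<n} d (\<lambda>t. K (s t))) {v. etype n s v w = f}
    \<le> 2 powr (- real n * MI_X2_Y_given_X1 f)"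
proof (cases "\<exists>v. etype n s v w = f")
  case False
  then show ?thesis by simp
next
  case True
  then have dist: "is_dist3 f" using is_dist3_etype[OF n] by blast
  then have "\<exists>Q. \<forall>b. marg1Y f a c * pmf Q b = f a b c" for a c
    unfolding marg1Y_def by (intro ex_pmf_proportional) (auto simp: is_dist3_def)
  then obtain V where V: "\<And>a b c. marg1Y f a c * pmf (V a c) b = f a b c" by metis
  define I where "I = MI_X2_Y_given_X1 f"
  have "measure_pmf.prob (Pi_pmf {..<n} d (\<lambda>t. K (s t))) {v. etype n s v w = f}
      \<le> 2 powr (- real n * I) *
        measure_pmf.prob (Pi_pmf {..<n} d (\<lambda>t. V (s t) (w t))) {v. etype n s v w = f}"
  proof (rule prob_le_of_pmf_le)
    fix v assume "v \<in> {v. etype n s v w = f}"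
    then have v: "f = etype n s v w" by simp
    let ?P = "\<Prod>t<n. pmf (K (s t)) (v t)" and ?Q = "\<Prod>t<n. pmf (V (s t) (w t)) (v t)"
    have "?P \<le> 2 powr (- real n * I) * ?Q"
    proof (cases "?P = 0")
      case True
      then show ?thesis unfolding True by (intro mult_nonneg_nonneg prod_nonneg) auto
    next
      case False
      then have Kp: "pmf (K (s t)) (v t) > 0" if "t < n" for t
        using that by (auto simp: less_le)
      \<comment> \<open>A triple of positive mass under the type occurs at some time, where
        \<open>K\<close> is positive because the whole product is.\<close>
      have Kf: "pmf (K a) b > 0" if "f a b c > 0" for a b c
      proof -
        have "{t\<in>{..<n}. s t = a \<and> v t = b \<and> w t = c} \<noteq> {}"
          using that by (auto simp: v etype_def zero_less_divide_iff card_gt_0_iff)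
        then show ?thesis using Kp by auto
      qed
      have Vp: "pmf (V (s t) (w t)) (v t) > 0" if "t < n" for t
      proof -
        have "t \<in> {t'\<in>{..<n}. s t' = s t \<and> v t' = v t \<and> w t' = w t}" using that by simp
        then have "f (s t) (v t) (w t) > 0"
          unfolding v etype_def using n by (auto simp: zero_less_divide_iff card_gt_0_iff)
        then show ?thesis using V[of "s t" "w t" "v t"] by (auto simp: less_le)
      qed
      \<comment> \<open>The expectation of the log ratio under the type, times \<open>n\<close>, is
        exactly the log ratio of the two product probabilities.\<close>
      have "real n * (ln 2 * I) \<le> real n * expect_q f (\<lambda>a b c. ln (pmf (V a c) b) - ln (pmf (K a) b))"
        using Gibbs_conditional[OF dist V Kf] by (intro mult_left_mono) (auto simp: I_def)
      also have "\<dots> = (\<Sum>t<n. ln (pmf (V (s t) (w t)) (v t)) - ln (pmf (K (s t)) (v t)))"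
        unfolding v by (rule sum_eq_etype[symmetric])
      also have "\<dots> = ln ?Q - ln ?P"
        using Kp Vp by (subst (1 2) ln_prod) (force simp: sum_subtractf)+
      finally have *: "real n * (ln 2 * I) \<le> ln ?Q - ln ?P" .
      have pos: "?P > 0" "?Q > 0" using Kp Vp by (auto intro: prod_pos)
      from * have "ln ?P \<le> ln (2 powr (- real n * I)) + ln ?Q"
        by (simp add: ln_powr algebra_simps)
      also have "\<dots> = ln (2 powr (- real n * I) * ?Q)"
        by (rule ln_mult_pos[symmetric]) (use pos in simp_all)
      finally show ?thesis
        using pos by (subst (asm) ln_le_cancel_iff) auto
    qed
    then show "pmf (Pi_pmf {..<n} d (\<lambda>t. K (s t))) v
        \<le> 2 powr (- real n * I) * pmf (Pi_pmf {..<n} d (\<lambda>t. V (s t) (w t))) v"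
      by (auto simp: pmf_Pi intro!: mult_nonneg_nonneg prod_nonneg)
  qed simp
  also have "\<dots> \<le> 2 powr (- real n * I) * 1"
    by (intro mult_left_mono) auto
  finally show ?thesis by (simp add: I_def)
qed

text \<open>The conditional bound with a trivial first letter; the marginal of \<open>f\<close> on
  the first letter and the output plays the role of the joint type.\<close>

lemma prob_type_X1_le:
  fixes f :: "'a::finite \<Rightarrow> 'b::finite \<Rightarrow> 'c::finite \<Rightarrow> real" and w :: "nat \<Rightarrow> 'c"
  assumes n: "0 < n" and f: "is_dist3 f"
  shows "measure_pmf.prob (Pi_pmf {..<n} d (\<lambda>_. K)) {u. etype2 n u w = marg1Y f}
    \<le> 2 powr (- real n * MI_X1_Y f)"
proof -
  let ?f = "\<lambda>(_ :: unit). marg1Y f"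
  have m1: "marg12 ?f () = marg1 f"
    unfolding marg12_def marg1_def marg1Y_def fun_eq_iff by (auto intro: sum.swap)
  have mY: "marg1Y ?f () = margY f"
    by (simp add: marg1Y_def margY_def fun_eq_iff)
  have "marg1 ?f () = (\<Sum>a\<in>UNIV. marg12 ?f () a)"
    by (simp add: marg1_def marg12_def)
  also have "\<dots> = 1" using f unfolding m1 by (simp add: marg1_def is_dist3_def)
  finally have one: "marg1 ?f () = 1" .
  have "MI_X2_Y_given_X1 ?f = MI_X1_Y f"
    by (simp add: MI_X2_Y_given_X1_def MI_X1_Y_def m1 mY one UNIV_unit)
  moreover have "{u. etype2 n u w = marg1Y f} = {u. etype n (\<lambda>_. ()) u w = ?f}"
    by (auto simp: fun_eq_iff etype_def etype2_def)
  ultimately show ?thesis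
    using prob_type_le[OF n, of d "\<lambda>_. K" "\<lambda>_. ()" w ?f] by simp
qed

text \<open>Drawing pairs letter by letter agrees with drawing a whole centre and then its
  satellite. This identifies superposition with an i.i.d. sequence of pairs.\<close>

lemma Pi_pmf_pair_conv:
  fixes n :: nat
  shows "Pi_pmf {..<n} d (\<lambda>t. bind_pmf (P t) (\<lambda>a. map_pmf (Pair a) (Q t a)))
    = bind_pmf (Pi_pmf {..<n} d1 P) (\<lambda>u. map_pmf (\<lambda>v t. if t < n then (u t, v t) else d)
        (Pi_pmf {..<n} d2 (\<lambda>t. Q t (u t))))"
proof -
  have "Pi_pmf {..<n} d (\<lambda>t. map_pmf (Pair (u t)) (Q t (u t)))
      = map_pmf (\<lambda>v t. if t < n then (u t, v t) else d) (Pi_pmf {..<n} d2 (\<lambda>t. Q t (u t)))" for u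
    unfolding map_pmf_def
    using Pi_pmf_bind[OF finite_lessThan, of n d "\<lambda>t. Q t (u t)" "\<lambda>t b. return_pmf (u t, b)" d2] by simp
  then show ?thesis
    using Pi_pmf_bind[OF finite_lessThan, of n d P "\<lambda>t a. map_pmf (Pair a) (Q t a)" d1] by simp
qed

text \<open>Centre and satellite together form one i.i.d. sequence over the product alphabet, to
  which the unconditional bound applies.\<close>

lemma prob_type_X1X2_le:
  fixes f :: "'a::finite \<Rightarrow> 'b::finite \<Rightarrow> 'c::finite \<Rightarrow> real" and w :: "nat \<Rightarrow> 'c"
  assumes n: "0 < n" and f: "is_dist3 f"
  shows "measure_pmf.prob (bind_pmf (Pi_pmf {..<n} d1 (\<lambda>_. P)) (\<lambda>u. map_pmf (Pair u)
      (Pi_pmf {..<n} d2 (\<lambda>t. Q (u t))))) {(u, v). etype n u v w = f}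
    \<le> 2 powr (- real n * MI_X1X2_Y f)"
proof -
  let ?f = "\<lambda>(_ :: unit) (a, b). f a b"
  have m1: "marg12 ?f () = (\<lambda>(a, b). marg12 f a b)"
    by (auto simp: marg12_def fun_eq_iff)
  have mY: "marg1Y ?f () = margY f"
    by (simp add: marg1Y_def margY_def fun_eq_iff sum_UNIV_prod)
  have "marg1 ?f () = 1"
    using f by (simp add: marg1_def is_dist3_def sum_UNIV_prod)
  then have MI: "MI_X2_Y_given_X1 ?f = MI_X1X2_Y f"
    by (simp add: MI_X2_Y_given_X1_def MI_X1X2_Y_def m1 mY UNIV_unit sum_UNIV_prod)
  let ?z = "\<lambda>u v t. if t < n then (u t, v t) else undefined"
  have eq: "etype n (\<lambda>_. ()) (?z u v) w = ?f \<longleftrightarrow> etype n u v w = f" for u :: "nat \<Rightarrow> 'a" and v :: "nat \<Rightarrow> 'b"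
  proof -
    have "etype n (\<lambda>_. ()) (?z u v) w () (a, b) c = etype n u v w a b c" for a b c
      unfolding etype_def by (rule arg_cong[where f = "\<lambda>A. real (card A) / real n"]) auto
    then show ?thesis by (auto simp: fun_eq_iff)
  qed
  have "measure_pmf.prob (bind_pmf (Pi_pmf {..<n} d1 (\<lambda>_. P)) (\<lambda>u. map_pmf (Pair u)
      (Pi_pmf {..<n} d2 (\<lambda>t. Q (u t))))) {(u, v). etype n u v w = f}
    = measure_pmf.prob (Pi_pmf {..<n} undefined (\<lambda>_. bind_pmf P (\<lambda>a. map_pmf (Pair a) (Q a))))
        {z. etype n (\<lambda>_. ()) z w = ?f}"
    unfolding Pi_pmf_pair_conv[where ?d1.0 = d1 and ?d2.0 = d2] measure_bind_pmf_expectation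
    by (simp add: vimage_def eq)
  also have "\<dots> \<le> 2 powr (- real n * MI_X1X2_Y f)"
    using prob_type_le[OF n, of undefined "\<lambda>_. bind_pmf P (\<lambda>a. map_pmf (Pair a) (Q a))" "\<lambda>_. ()" w ?f]
    by (simp add: MI)
  finally show ?thesis .
qed

text \<open>Hoeffding's inequality for the indicator of each letter, followed by a union bound over
  the finite alphabet.\<close>

lemma iid_concentration:
  fixes P :: "'s::finite pmf"
  assumes \<delta>: "0 < \<delta>" and n: "0 < n"
  shows "measure_pmf.prob (Pi_pmf {..<n} d (\<lambda>_. P))
      {z. \<exists>x. \<bar>real (card {t\<in>{..<n}. z t = x}) / real n - pmf P x\<bar> \<ge> \<delta>}
    \<le> real CARD('s) * (2 * exp (- 2 * real n * \<delta>\<^sup>2))"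
proof -
  let ?M = "Pi_pmf {..<n} d (\<lambda>_. P)"
  let ?B = "\<lambda>x. {z. \<bar>real (card {t\<in>{..<n}. z t = x}) / real n - pmf P x\<bar> \<ge> \<delta>}"
  have B: "measure_pmf.prob ?M (?B x) \<le> 2 * exp (- 2 * real n * \<delta>\<^sup>2)" for x
  proof -
    have E: "measure_pmf.expectation ?M (\<lambda>z. of_bool (z t = x)) = pmf P x" if "t < n" for t
    proof -
      have "(\<lambda>z. of_bool (z t = x)) = (indicator ((\<lambda>z. z t) -` {x}) :: _ \<Rightarrow> real)"
        by (auto simp: fun_eq_iff indicator_def)
      then have "measure_pmf.expectation ?M (\<lambda>z. of_bool (z t = x))
          = measure_pmf.prob (map_pmf (\<lambda>z. z t) ?M) {x}"
        by simp
      also have "\<dots> = pmf P x"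
        using that by (simp add: Pi_pmf_component measure_pmf_single del: measure_map_pmf)
      finally show ?thesis .
    qed
    interpret Hoeffding_ineq ?M "{..<n}" "\<lambda>t z. of_bool (z t = x)" "\<lambda>_. 0" "\<lambda>_. 1" "real n * pmf P x"
    proof unfold_locales
      show "prob_space.indep_vars (measure_pmf ?M) (\<lambda>_. borel) (\<lambda>t z. of_bool (z t = x)) {..<n}"
        by (intro prob_space.indep_vars_compose2[OF _ indep_vars_Pi_pmf])
           (auto simp: measure_pmf.prob_space_axioms)
    qed (auto simp: E)
    have sum: "(\<Sum>t<n. of_bool (z t = x)) = real (card {t\<in>{..<n}. z t = x})" for z
      by (simp add: sum.inter_filter[symmetric] of_bool_def)
    have "?B x = {z \<in> space ?M. \<bar>(\<Sum>t<n. of_bool (z t = x)) - real n * pmf P x\<bar> \<ge> real n * \<delta>}"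
    proof -
      have "real n * \<bar>k / real n - p\<bar> = \<bar>k - real n * p\<bar>" for k p :: real
        using n by (simp add: abs_mult[symmetric, of "real n", simplified] right_diff_distrib)
      then have "\<bar>k / real n - p\<bar> \<ge> \<delta> \<longleftrightarrow> \<bar>k - real n * p\<bar> \<ge> real n * \<delta>" for k p :: real
        using n by (metis mult_le_cancel_left_pos of_nat_0_less_iff)
      then show ?thesis by (simp add: sum)
    qed
    then show ?thesis
      using Hoeffding_ineq_abs_ge[of "real n * \<delta>"] \<delta> n by (simp add: power2_eq_square mult_ac)
  qed
  have "{z. \<exists>x. \<bar>real (card {t\<in>{..<n}. z t = x}) / real n - pmf P x\<bar> \<ge> \<delta>} = (\<Union>x. ?B x)" by auto
  also have "measure_pmf.prob ?M (\<Union>x. ?B x) \<le> (\<Sum>x\<in>UNIV. measure_pmf.prob ?M (?B x))"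
    by (rule measure_pmf.finite_measure_subadditive_finite) auto
  also have "\<dots> \<le> (\<Sum>x\<in>(UNIV :: 's set). 2 * exp (- 2 * real n * \<delta>\<^sup>2))"
    by (intro sum_mono B)
  finally show ?thesis by simp
qed

section \<open>Continuity of mutual information\<close>

text \<open>A majorant that vanishes at 0, which gives continuity of \<open>x * ln x\<close> there.
  The lower estimate comes from \<open>ln y \<le> y\<close> at \<open>1 / sqrt x\<close>, the upper
  one from \<open>ln y \<le> y\<close> at \<open>x\<close> itself.\<close>

lemma abs_x_ln_x_le:
  assumes "0 \<le> (x::real)"
  shows "\<bar>x * ln x\<bar> \<le> 2 * sqrt x + x\<^sup>2"
proof (cases "x = 0")
  case False
  then have x: "x > 0" using assms by simp
  have "ln (1 / sqrt x) \<le> 1 / sqrt x"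
    using x by (intro ln_bound) simp
  then have "- ln x \<le> 2 * (1 / sqrt x)"
    using x by (simp add: ln_div ln_sqrt)
  then have "x * - ln x \<le> x * (2 * (1 / sqrt x))"
    using x by (intro mult_left_mono) auto
  also have "\<dots> = 2 * (x / sqrt x)" by simp
  also have "\<dots> = 2 * sqrt x" using x by (simp only: real_div_sqrt less_imp_le)
  finally have a: "- (x * ln x) \<le> 2 * sqrt x" by simp
  have "x * ln x \<le> x * x"
    using x ln_bound[of x] by (intro mult_left_mono) auto
  then have b: "x * ln x \<le> x\<^sup>2" by (simp add: power2_eq_square)
  have "0 \<le> 2 * sqrt x" "0 \<le> x\<^sup>2" using x by auto
  with a b show ?thesis by linarith
qed simp

lemma tendsto_x_log_x:
  fixes X :: "nat \<Rightarrow> real"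
  assumes "X \<longlonglongrightarrow> x" "\<And>k. 0 \<le> X k"
  shows "(\<lambda>k. X k * log 2 (X k)) \<longlonglongrightarrow> x * log 2 x"
proof (cases "x = 0")
  case True
  have "(\<lambda>k. 2 * sqrt (X k) + (X k)\<^sup>2) \<longlonglongrightarrow> 2 * sqrt 0 + 0\<^sup>2"
    using assms True by (intro tendsto_intros) auto
  then have lim: "(\<lambda>k. 2 * sqrt (X k) + (X k)\<^sup>2) \<longlonglongrightarrow> 0" by simp
  have "(\<lambda>k. X k * ln (X k)) \<longlonglongrightarrow> 0"
    by (rule Lim_null_comparison[OF _ lim])
       (simp only: real_norm_def abs_x_ln_x_le[OF assms(2)] eventually_True)
  then have "(\<lambda>k. X k * ln (X k) / ln 2) \<longlonglongrightarrow> 0 / ln 2"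
    by (intro tendsto_intros) auto
  then show ?thesis using True by (simp add: log_def)
next
  case False
  then show ?thesis using assms(1) unfolding log_def by (intro tendsto_intros) auto
qed

text \<open>Being dominated by all three factors replaces positivity: either \<open>p\<close>
  vanishes, or every logarithm has a positive argument.\<close>

lemma plog_quotient:
  assumes "0 \<le> p" "p \<le> x" "p \<le> y" "p \<le> z"
  shows "plog p (x * y / z) = p * log 2 p + p * log 2 z - p * log 2 x - p * log 2 y"
proof (cases "p = 0")
  case False
  then show ?thesis using assms
    by (simp add: plog_def log_divide log_mult algebra_simps)
qed (simp add: plog_def)

lemma plog_product:
  assumes "0 \<le> p" "p \<le> x" "p \<le> y"
  shows "plog p (x * y) = p * log 2 p - p * log 2 x - p * log 2 y"
proof (cases "p = 0")
  case False
  then show ?thesis using assms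
    by (simp add: plog_def log_divide log_mult algebra_simps)
qed (simp add: plog_def)

context
  fixes f :: "'a::finite \<Rightarrow> 'b::finite \<Rightarrow> 'c::finite \<Rightarrow> real"
  assumes nn: "\<And>a b c. 0 \<le> f a b c"
begin

lemma marg_nonneg:
  "0 \<le> marg12 f a b" "0 \<le> marg1Y f a c" "0 \<le> marg1 f a" "0 \<le> margY f c"
  by (auto simp: marg12_def marg1Y_def marg1_def margY_def intro!: sum_nonneg nn)

lemma marg1_eq: "marg1 f a = (\<Sum>b\<in>UNIV. marg12 f a b)" "marg1 f a = (\<Sum>c\<in>UNIV. marg1Y f a c)"
  by (auto simp: marg1_def marg12_def marg1Y_def intro: sum.swap)

lemma margY_eq: "margY f c = (\<Sum>a\<in>UNIV. marg1Y f a c)"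
  by (simp add: margY_def marg1Y_def)

lemma le_marg:
  "f a b c \<le> marg12 f a b" "f a b c \<le> marg1Y f a c" "marg12 f a b \<le> marg1 f a"
  "marg1Y f a c \<le> marg1 f a" "marg1Y f a c \<le> margY f c"
proof -
  show "f a b c \<le> marg12 f a b"
    unfolding marg12_def using member_le_sum[of c UNIV "f a b"] nn by auto
  show "f a b c \<le> marg1Y f a c"
    unfolding marg1Y_def using member_le_sum[of b UNIV "\<lambda>b. f a b c"] nn by auto
  show "marg12 f a b \<le> marg1 f a"
    unfolding marg1_eq(1) using member_le_sum[of b UNIV "marg12 f a"] marg_nonneg by auto
  show "marg1Y f a c \<le> marg1 f a"
    unfolding marg1_eq(2) using member_le_sum[of c UNIV "marg1Y f a"] marg_nonneg by auto
  show "marg1Y f a c \<le> margY f c"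
    unfolding margY_eq using member_le_sum[of a UNIV "\<lambda>a. marg1Y f a c"] marg_nonneg by auto
qed

text \<open>Entropy form of the information. Each summand is \<open>x * log 2 x\<close> of one
  marginal entry, which is continuous up to 0, unlike the ratios in the definition.\<close>

lemma MI_X2_Y_given_X1_entropies:
  "MI_X2_Y_given_X1 f = (\<Sum>a\<in>UNIV. \<Sum>b\<in>UNIV. \<Sum>c\<in>UNIV. f a b c * log 2 (f a b c))
    + (\<Sum>a\<in>UNIV. marg1 f a * log 2 (marg1 f a))
    - (\<Sum>a\<in>UNIV. \<Sum>b\<in>UNIV. marg12 f a b * log 2 (marg12 f a b))
    - (\<Sum>a\<in>UNIV. \<Sum>c\<in>UNIV. marg1Y f a c * log 2 (marg1Y f a c))"
proof -
  have "plog (f a b c) (marg12 f a b * marg1Y f a c / marg1 f a) = f a b c * log 2 (f a b c)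
      + f a b c * log 2 (marg1 f a) - f a b c * log 2 (marg12 f a b) - f a b c * log 2 (marg1Y f a c)" for a b c
    by (intro plog_quotient nn le_marg order_trans[OF le_marg(1) le_marg(3)])
  moreover have "(\<Sum>a\<in>UNIV. \<Sum>b\<in>UNIV. \<Sum>c\<in>UNIV. f a b c * log 2 (marg1 f a))
      = (\<Sum>a\<in>UNIV. marg1 f a * log 2 (marg1 f a))"
    by (simp add: sum_distrib_right[symmetric] marg1_def)
  moreover have "(\<Sum>a\<in>UNIV. \<Sum>b\<in>UNIV. \<Sum>c\<in>UNIV. f a b c * log 2 (marg12 f a b))
      = (\<Sum>a\<in>UNIV. \<Sum>b\<in>UNIV. marg12 f a b * log 2 (marg12 f a b))"
    by (simp add: sum_distrib_right[symmetric] marg12_def)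
  moreover have "(\<Sum>a\<in>UNIV. \<Sum>b\<in>UNIV. \<Sum>c\<in>UNIV. f a b c * log 2 (marg1Y f a c))
      = (\<Sum>a\<in>UNIV. \<Sum>c\<in>UNIV. marg1Y f a c * log 2 (marg1Y f a c))"
    by (intro sum.cong refl, subst sum.swap) (simp add: sum_distrib_right[symmetric] marg1Y_def)
  ultimately show ?thesis
    by (simp add: MI_X2_Y_given_X1_def sum.distrib sum_subtractf)
qed

lemma MI_X1_Y_entropies:
  "MI_X1_Y f = (\<Sum>a\<in>UNIV. \<Sum>c\<in>UNIV. marg1Y f a c * log 2 (marg1Y f a c))
    - (\<Sum>a\<in>UNIV. marg1 f a * log 2 (marg1 f a)) - (\<Sum>c\<in>UNIV. margY f c * log 2 (margY f c))"
proof -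
  have "plog (marg1Y f a c) (marg1 f a * margY f c) = marg1Y f a c * log 2 (marg1Y f a c)
      - marg1Y f a c * log 2 (marg1 f a) - marg1Y f a c * log 2 (margY f c)" for a c
    by (intro plog_product marg_nonneg le_marg)
  moreover have "(\<Sum>a\<in>UNIV. \<Sum>c\<in>UNIV. marg1Y f a c * log 2 (marg1 f a))
      = (\<Sum>a\<in>UNIV. marg1 f a * log 2 (marg1 f a))"
    by (simp add: sum_distrib_right[symmetric] marg1_eq(2))
  moreover have "(\<Sum>a\<in>UNIV. \<Sum>c\<in>UNIV. marg1Y f a c * log 2 (margY f c))
      = (\<Sum>c\<in>UNIV. margY f c * log 2 (margY f c))"
    by (subst sum.swap) (simp add: sum_distrib_right[symmetric] margY_eq)
  ultimately show ?thesis
    by (simp add: MI_X1_Y_def sum_subtractf)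
qed

lemma MI_X1X2_Y_entropies:
  "MI_X1X2_Y f = (\<Sum>a\<in>UNIV. \<Sum>b\<in>UNIV. \<Sum>c\<in>UNIV. f a b c * log 2 (f a b c))
    - (\<Sum>a\<in>UNIV. \<Sum>b\<in>UNIV. marg12 f a b * log 2 (marg12 f a b))
    - (\<Sum>c\<in>UNIV. margY f c * log 2 (margY f c))"
proof -
  have "plog (f a b c) (marg12 f a b * margY f c) = f a b c * log 2 (f a b c)
      - f a b c * log 2 (marg12 f a b) - f a b c * log 2 (margY f c)" for a b c
    by (intro plog_product nn le_marg order_trans[OF le_marg(2) le_marg(5)])
  moreover have "(\<Sum>a\<in>UNIV. \<Sum>b\<in>UNIV. \<Sum>c\<in>UNIV. f a b c * log 2 (marg12 f a b))
      = (\<Sum>a\<in>UNIV. \<Sum>b\<in>UNIV. marg12 f a b * log 2 (marg12 f a b))"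
    by (simp add: sum_distrib_right[symmetric] marg12_def)
  moreover have "(\<Sum>a\<in>UNIV. \<Sum>b\<in>UNIV. \<Sum>c\<in>UNIV. f a b c * log 2 (margY f c))
      = (\<Sum>c\<in>UNIV. \<Sum>a\<in>UNIV. \<Sum>b\<in>UNIV. f a b c * log 2 (margY f c))"
    by (subst (2) sum.swap, subst sum.swap) (rule refl)
  then have "(\<Sum>a\<in>UNIV. \<Sum>b\<in>UNIV. \<Sum>c\<in>UNIV. f a b c * log 2 (margY f c))
      = (\<Sum>c\<in>UNIV. margY f c * log 2 (margY f c))"
    by (simp add: sum_distrib_right[symmetric] margY_def)
  ultimately show ?thesis
    by (simp add: MI_X1X2_Y_def sum_subtractf)
qed

end

section \<open>Compactness of the simplex and relaxed constraints\<close>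

definition dist_conv :: "(nat \<Rightarrow> 'a::finite \<Rightarrow> 'b::finite \<Rightarrow> 'c::finite \<Rightarrow> real) \<Rightarrow> ('a \<Rightarrow> 'b \<Rightarrow> 'c \<Rightarrow> real) \<Rightarrow> bool" where
  "dist_conv F f \<longleftrightarrow> (\<forall>a b c. (\<lambda>k. F k a b c) \<longlonglongrightarrow> f a b c)"

lemma dist_conv_marg:
  assumes "dist_conv F f"
  shows "(\<lambda>k. F k a b c) \<longlonglongrightarrow> f a b c"
    "(\<lambda>k. marg12 (F k) a b) \<longlonglongrightarrow> marg12 f a b" "(\<lambda>k. marg1Y (F k) a c) \<longlonglongrightarrow> marg1Y f a c"
    "(\<lambda>k. marg1 (F k) a) \<longlonglongrightarrow> marg1 f a" "(\<lambda>k. margY (F k) c) \<longlonglongrightarrow> margY f c"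
    "(\<lambda>k. expect_q (F k) q) \<longlonglongrightarrow> expect_q f q"
  using assms unfolding dist_conv_def marg12_def marg1Y_def marg1_def margY_def expect_q_def
  by (auto intro!: tendsto_sum tendsto_mult)

lemma dist_conv_MI:
  assumes "dist_conv F f" "\<And>k. is_dist3 (F k)" "is_dist3 f"
  shows "(\<lambda>k. MI_X2_Y_given_X1 (F k)) \<longlonglongrightarrow> MI_X2_Y_given_X1 f"
    "(\<lambda>k. MI_X1_Y (F k)) \<longlonglongrightarrow> MI_X1_Y f"
    "(\<lambda>k. MI_X1X2_Y (F k)) \<longlonglongrightarrow> MI_X1X2_Y f"
proof -
  have nn: "0 \<le> F k a b c" "0 \<le> f a b c" for k a b c
    using assms by (auto simp: is_dist3_def)
  show "(\<lambda>k. MI_X2_Y_given_X1 (F k)) \<longlonglongrightarrow> MI_X2_Y_given_X1 f"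
    unfolding MI_X2_Y_given_X1_entropies[OF nn(1)] MI_X2_Y_given_X1_entropies[OF nn(2)]
    by (intro tendsto_add tendsto_diff tendsto_sum tendsto_x_log_x dist_conv_marg[OF assms(1)] nn marg_nonneg)
  show "(\<lambda>k. MI_X1_Y (F k)) \<longlonglongrightarrow> MI_X1_Y f"
    unfolding MI_X1_Y_entropies[OF nn(1)] MI_X1_Y_entropies[OF nn(2)]
    by (intro tendsto_add tendsto_diff tendsto_sum tendsto_x_log_x dist_conv_marg[OF assms(1)] nn marg_nonneg)
  show "(\<lambda>k. MI_X1X2_Y (F k)) \<longlonglongrightarrow> MI_X1X2_Y f"
    unfolding MI_X1X2_Y_entropies[OF nn(1)] MI_X1X2_Y_entropies[OF nn(2)]
    by (intro tendsto_add tendsto_diff tendsto_sum tendsto_x_log_x dist_conv_marg[OF assms(1)] nn marg_nonneg)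
qed

text \<open>Bolzano-Weierstrass in the Euclidean space indexed by triples of letters; the simplex
  constraints pass to the limit.\<close>

lemma dist_seq_compact:
  fixes F :: "nat \<Rightarrow> 'a::finite \<Rightarrow> 'b::finite \<Rightarrow> 'c::finite \<Rightarrow> real"
  assumes dist: "\<And>k. is_dist3 (F k)"
  shows "\<exists>r f. strict_mono r \<and> is_dist3 f \<and> dist_conv (F \<circ> r) f"
proof -
  define x :: "nat \<Rightarrow> real ^ ('a \<times> 'b \<times> 'c)" where "x k = (\<chi> p. F k (fst p) (fst (snd p)) (snd (snd p)))" for k
  have "norm (x k) \<le> 1" for k
  proof -
    have "norm (x k) \<le> (\<Sum>p\<in>UNIV. \<bar>x k $ p\<bar>)" by (rule norm_le_l1_cart)
    also have "\<dots> = (\<Sum>a\<in>UNIV. \<Sum>b\<in>UNIV. \<Sum>c\<in>UNIV. F k a b c)"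
      using dist[of k] by (simp add: x_def sum_UNIV_prod is_dist3_def)
    finally show ?thesis using dist[of k] by (simp add: is_dist3_def)
  qed
  then have "\<forall>k. x k \<in> cball 0 1" by simp
  then obtain l r where r: "strict_mono r" and l: "(x \<circ> r) \<longlonglongrightarrow> l"
    using compact_cball[of "0 :: real ^ ('a \<times> 'b \<times> 'c)" 1] unfolding compact_def by blast
  define f where "f a b c = l $ (a, b, c)" for a b c
  have conv: "(\<lambda>k. F (r k) a b c) \<longlonglongrightarrow> f a b c" for a b c
    using tendsto_vec_nth[OF l, of "(a, b, c)"] by (simp add: x_def f_def)
  have "0 \<le> f a b c" for a b c
    using conv[of a b c] dist by (intro LIMSEQ_le_const[OF conv]) (auto simp: is_dist3_def)
  moreover have "(\<lambda>k. \<Sum>a\<in>UNIV. \<Sum>b\<in>UNIV. \<Sum>c\<in>UNIV. F (r k) a b c)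
      \<longlonglongrightarrow> (\<Sum>a\<in>UNIV. \<Sum>b\<in>UNIV. \<Sum>c\<in>UNIV. f a b c)"
    by (intro tendsto_sum conv)
  then have "(\<Sum>a\<in>UNIV. \<Sum>b\<in>UNIV. \<Sum>c\<in>UNIV. f a b c) = 1"
    using dist LIMSEQ_unique[OF _ tendsto_const] by (fastforce simp: is_dist3_def)
  ultimately show ?thesis
    using r conv by (intro exI[of _ r] exI[of _ f]) (auto simp: is_dist3_def dist_conv_def)
qed

text \<open>\<open>D\<close> measures the violation of the constraints and \<open>B\<close> is a
  closed bad event. Bad distributions with violation at most \<open>1 / real (Suc k)\<close> for
  every \<open>k\<close> would accumulate at a bad one without violation.\<close>

lemma compact_slack:
  fixes D :: "('a::finite \<Rightarrow> 'b::finite \<Rightarrow> 'c::finite \<Rightarrow> real) \<Rightarrow> real"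
  assumes D: "\<And>F f. dist_conv F f \<Longrightarrow> (\<lambda>k. D (F k)) \<longlonglongrightarrow> D f"
    and B: "\<And>F f. (\<And>k. is_dist3 (F k)) \<Longrightarrow> (\<And>k. B (F k)) \<Longrightarrow> is_dist3 f \<Longrightarrow> dist_conv F f \<Longrightarrow> B f"
    and none: "\<And>f. is_dist3 f \<Longrightarrow> D f \<le> 0 \<Longrightarrow> \<not> B f"
  shows "\<exists>\<eta>>0. \<forall>f. is_dist3 f \<longrightarrow> D f \<le> \<eta> \<longrightarrow> \<not> B f"
proof (rule ccontr)
  assume "\<not> ?thesis"
  then have "\<forall>k. \<exists>f. is_dist3 f \<and> D f \<le> 1 / real (Suc k) \<and> B f"
    by (metis of_nat_0_less_iff zero_less_Suc zero_less_divide_1_iff)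
  then obtain F where F: "\<And>k. is_dist3 (F k)" "\<And>k. D (F k) \<le> 1 / real (Suc k)" "\<And>k. B (F k)"
    by metis
  obtain r f where r: "strict_mono r" and f: "is_dist3 f" and conv: "dist_conv (F \<circ> r) f"
    using dist_seq_compact[of F] F(1) by blast
  have "(\<lambda>k. 1 / real (Suc (r k))) \<longlonglongrightarrow> 0"
    using LIMSEQ_subseq_LIMSEQ[OF LIMSEQ_Suc[OF lim_1_over_n] r] by (simp add: o_def)
  then have "D f \<le> 0"
    using F(2) by (intro LIMSEQ_le[OF D[OF conv]]) auto
  moreover have "B f" using B[of "F \<circ> r" f] F f conv by simp
  ultimately show False using none f by blast
qed

definition dev12 where "dev12 P f = (\<Sum>a\<in>UNIV. \<Sum>b\<in>UNIV. \<bar>marg12 f a b - marg12 P a b\<bar>)"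
definition dev1Y where "dev1Y P f = (\<Sum>a\<in>UNIV. \<Sum>c\<in>UNIV. \<bar>marg1Y f a c - marg1Y P a c\<bar>)"
definition devY where "devY P f = (\<Sum>c\<in>UNIV. \<bar>margY f c - margY P c\<bar>)"

lemma dev12_nonneg: "0 \<le> dev12 P f" and dev1Y_nonneg: "0 \<le> dev1Y P f" and devY_nonneg: "0 \<le> devY P f"
  by (auto simp: dev12_def dev1Y_def devY_def intro!: sum_nonneg)

lemma dev12_zero: "dev12 P f = 0 \<longleftrightarrow> marg12 f = marg12 P"
  and dev1Y_zero: "dev1Y P f = 0 \<longleftrightarrow> marg1Y f = marg1Y P"
  and devY_zero: "devY P f = 0 \<longleftrightarrow> margY f = margY P"
  by (auto simp: dev12_def dev1Y_def devY_def sum_nonneg_eq_0_iff sum_nonneg fun_eq_iff)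

lemma dev_tendsto:
  assumes "dist_conv F f"
  shows "(\<lambda>k. dev12 P (F k)) \<longlonglongrightarrow> dev12 P f" "(\<lambda>k. dev1Y P (F k)) \<longlonglongrightarrow> dev1Y P f"
    "(\<lambda>k. devY P (F k)) \<longlonglongrightarrow> devY P f"
  unfolding dev12_def dev1Y_def devY_def
  by (intro tendsto_sum tendsto_rabs tendsto_diff dist_conv_marg[OF assms] tendsto_const)+

text \<open>The bad event is the closed condition that the information is at most
  \<open>R - \<delta>\<close>; the loss \<delta> makes it incompatible with the bound
  \<open>R\<close> on \<open>L2\<close> itself.\<close>

lemma L2_slack:
  assumes "\<And>f. f \<in> L2 q P \<Longrightarrow> R \<le> MI_X2_Y_given_X1 f" "0 < \<delta>"
  shows "\<exists>\<eta>>0. \<forall>f. is_dist3 f \<longrightarrow> dev12 P f \<le> \<eta> \<longrightarrow> dev1Y P f \<le> \<eta> \<longrightarrow>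
    expect_q f q \<ge> expect_q P q - \<eta> \<longrightarrow> R - \<delta> \<le> MI_X2_Y_given_X1 f"
proof -
  \<comment> \<open>The maximum packs three constraints into one continuous quantity; it is
    nonpositive on the simplex exactly on \<open>L2 q P\<close>.\<close>
  let ?D = "\<lambda>f. max (dev12 P f) (max (dev1Y P f) (expect_q P q - expect_q f q))"
  have "\<exists>\<eta>>0. \<forall>f. is_dist3 f \<longrightarrow> ?D f \<le> \<eta> \<longrightarrow> \<not> MI_X2_Y_given_X1 f \<le> R - \<delta>"
  proof (rule compact_slack)
    fix f assume f: "is_dist3 f" "?D f \<le> 0"
    then have "dev12 P f = 0" "dev1Y P f = 0" "expect_q f q \<ge> expect_q P q"
      using dev12_nonneg[of P f] dev1Y_nonneg[of P f] by auto
    then have "f \<in> L2 q P"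
      using f by (simp add: L2_def G_q_def dev12_zero dev1Y_zero)
    from assms(1)[OF this] show "\<not> MI_X2_Y_given_X1 f \<le> R - \<delta>" using assms(2) by simp
  next
    fix F f assume "\<And>k. is_dist3 (F k)" "\<And>k. MI_X2_Y_given_X1 (F k) \<le> R - \<delta>" "is_dist3 f" "dist_conv F f"
    then show "MI_X2_Y_given_X1 f \<le> R - \<delta>"
      by (intro LIMSEQ_le_const2[OF dist_conv_MI(1)[of F f]]) auto
  qed (intro tendsto_max dev_tendsto tendsto_diff tendsto_const dist_conv_marg)
  then obtain \<eta> where "\<eta> > 0" "\<And>f. is_dist3 f \<Longrightarrow> ?D f \<le> \<eta> \<Longrightarrow> \<not> MI_X2_Y_given_X1 f \<le> R - \<delta>" by blast
  then show ?thesis by (intro exI[of _ \<eta>]) (auto simp: not_le intro: less_imp_le)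
qed

text \<open>Both alternatives are negated together. A limit of bad types has
  \<open>MI_X1_Y f \<le> R1 - \<delta>\<close>, hence satisfies the side condition with
  \<open>R1\<close>, and the hypothesis on \<open>L0\<close> then contradicts the second half of
  \<open>?B\<close>.\<close>

lemma L0_slack:
  assumes "\<And>f. f \<in> L0 q P \<Longrightarrow> MI_X1_Y f \<le> R1 \<Longrightarrow> R \<le> MI_X1X2_Y f" "0 < \<delta>"
  shows "\<exists>\<eta>>0. \<forall>f. is_dist3 f \<longrightarrow> dev12 P f \<le> \<eta> \<longrightarrow> devY P f \<le> \<eta> \<longrightarrow>
    expect_q f q \<ge> expect_q P q - \<eta> \<longrightarrow> R1 - \<delta> \<le> MI_X1_Y f \<or> R - \<delta> \<le> MI_X1X2_Y f"
proof -
  let ?D = "\<lambda>f. max (dev12 P f) (max (devY P f) (expect_q P q - expect_q f q))"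
  let ?B = "\<lambda>f. MI_X1_Y f \<le> R1 - \<delta> \<and> MI_X1X2_Y f \<le> R - \<delta>"
  have "\<exists>\<eta>>0. \<forall>f. is_dist3 f \<longrightarrow> ?D f \<le> \<eta> \<longrightarrow> \<not> ?B f"
  proof (rule compact_slack)
    fix f assume f: "is_dist3 f" "?D f \<le> 0"
    then have "dev12 P f = 0" "devY P f = 0" "expect_q f q \<ge> expect_q P q"
      using dev12_nonneg[of P f] devY_nonneg[of P f] by auto
    then have "f \<in> L0 q P"
      using f by (simp add: L0_def G_q_def dev12_zero devY_zero)
    from assms(1)[OF this] show "\<not> ?B f" using assms(2) by auto
  next
    fix F f assume "\<And>k. is_dist3 (F k)" "\<And>k. ?B (F k)" "is_dist3 f" "dist_conv F f"
    then show "?B f"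
      by (intro conjI LIMSEQ_le_const2[OF dist_conv_MI(2)[of F f]] LIMSEQ_le_const2[OF dist_conv_MI(3)[of F f]]) auto
  qed (intro tendsto_max dev_tendsto tendsto_diff tendsto_const dist_conv_marg)
  then obtain \<eta> where "\<eta> > 0" "\<And>f. is_dist3 f \<Longrightarrow> ?D f \<le> \<eta> \<Longrightarrow> \<not> ?B f" by blast
  then show ?thesis by (intro exI[of _ \<eta>]) (fastforce simp: not_le)
qed

section \<open>Time sharing\<close>

definition msg_error where
  "msg_error W q n M1 M2 x1 x2 i j = (\<Sum>y\<in>({..<n} \<rightarrow>\<^sub>E UNIV).
     if decodes_correctly q n M1 M2 x1 x2 i j y then 0 else (\<Prod>t<n. W (x1 i t) (x2 i j t) (y t)))"

lemma avg_error_msg_error: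
  "avg_error W q n M1 M2 x1 x2 = 1 / (real M1 * real M2) * (\<Sum>i<M1. \<Sum>j<M2. msg_error W q n M1 M2 x1 x2 i j)"
  by (simp add: avg_error_def msg_error_def)

text \<open>The default \<open>undefined\<close> outside \<open>{..<n}\<close> makes the support
  consist of extensional functions, the output sequences over which \<open>avg_error\<close>
  sums.\<close>

definition seq_channel :: "('a \<Rightarrow> 'b \<Rightarrow> 'c pmf) \<Rightarrow> nat \<Rightarrow> (nat \<Rightarrow> 'a) \<Rightarrow> (nat \<Rightarrow> 'b) \<Rightarrow> (nat \<Rightarrow> 'c) pmf" where
  "seq_channel K n u v = Pi_pmf {..<n} undefined (\<lambda>t. K (u t) (v t))"

lemma msg_error_prob:
  fixes W :: "'a::finite \<Rightarrow> 'b::finite \<Rightarrow> 'c::finite \<Rightarrow> real"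
  assumes K: "\<And>a b c. pmf (K a b) c = W a b c"
  shows "msg_error W q n M1 M2 x1 x2 i j
    = measure_pmf.prob (seq_channel K n (x1 i) (x2 i j)) {y. \<not> decodes_correctly q n M1 M2 x1 x2 i j y}"
proof -
  let ?p = "seq_channel K n (x1 i) (x2 i j)" and ?E = "{y. \<not> decodes_correctly q n M1 M2 x1 x2 i j y}"
  let ?S = "({..<n} \<rightarrow>\<^sub>E UNIV) :: (nat \<Rightarrow> 'c) set"
  have fin: "finite ?S" by (intro finite_PiE) auto
  have "set_pmf ?p \<subseteq> ?S"
    by (auto simp: seq_channel_def set_Pi_pmf PiE_dflt_def PiE_def extensional_def)
  then have "measure_pmf.prob ?p ?E = measure_pmf.prob ?p (?E \<inter> ?S)"
    by (intro measure_prob_cong_0) (auto simp: set_pmf_iff)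
  also have "\<dots> = (\<Sum>y\<in>?E \<inter> ?S. pmf ?p y)"
    using fin by (intro measure_measure_pmf_finite) auto
  also have "\<dots> = (\<Sum>y\<in>?E \<inter> ?S. \<Prod>t<n. W (x1 i t) (x2 i j t) (y t))"
    by (intro sum.cong refl) (auto simp: seq_channel_def pmf_Pi K PiE_def extensional_def)
  also have "\<dots> = msg_error W q n M1 M2 x1 x2 i j"
    unfolding msg_error_def using fin by (intro sum.mono_neutral_cong_left) auto
  finally show ?thesis by simp
qed

lemma is_channel_pmf:
  assumes "is_channel W"
  shows "\<exists>K. \<forall>a b c. pmf (K a b) c = W a b c"
proof -
  have "\<forall>a b. \<exists>Q. \<forall>c. pmf Q c = W a b c"
    using assms by (intro allI ex_pmf_of_fun) (auto simp: is_channel_def)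
  then show ?thesis by metis
qed

text \<open>Removing a largest element never raises the average; this is repeated until
  \<open>m\<close> elements remain.\<close>

lemma ex_subset_average_le:
  fixes f :: "'i \<Rightarrow> real"
  assumes "finite T" "0 < m" "m \<le> card T"
  shows "\<exists>S\<subseteq>T. card S = m \<and> sum f S / real m \<le> sum f T / real (card T)"
  using assms
proof (induction "card T - m" arbitrary: T)
  case 0
  then show ?case by (intro exI[of _ T]) auto
next
  case (Suc k)
  then have T: "card T > m" "T \<noteq> {}" by auto
  have "Max (f ` T) \<in> f ` T" using Suc.prems(1) T(2) by (intro Max_in) auto
  then obtain x where "x \<in> T" "f x = Max (f ` T)" by auto
  then have x: "x \<in> T" "\<And>y. y \<in> T \<Longrightarrow> f y \<le> f x"
    using Suc.prems(1) by auto
  have card: "card (T - {x}) = card T - 1" using x Suc.prems by simp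
  have "sum f (T - {x}) \<le> (\<Sum>y\<in>T - {x}. f x)" by (intro sum_mono x) auto
  then have le: "sum f (T - {x}) \<le> real (card T - 1) * f x" using card by simp
  have sum: "sum f T = f x + sum f (T - {x})"
    using x Suc.prems by (simp add: sum.remove)
  have "sum f (T - {x}) / real (card T - 1) \<le> sum f T / real (card T)"
  proof -
    obtain c where c: "card T = Suc c" "c > 0" using T(1) Suc.prems by (cases "card T") auto
    show ?thesis using le c unfolding sum by (simp add: field_simps)
  qed
  moreover obtain S where "S \<subseteq> T - {x}" "card S = m"
      "sum f S / real m \<le> sum f (T - {x}) / real (card (T - {x}))"
  proof -
    have "\<exists>S\<subseteq>T - {x}. card S = m \<and> sum f S / real m \<le> sum f (T - {x}) / real (card (T - {x}))"
      using Suc.hyps(2) Suc.prems T card by (intro Suc.hyps(1)) auto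
    then show ?thesis using that by blast
  qed
  ultimately show ?case
    unfolding card by (intro exI[of _ S]) auto
qed

lemma ex_inj_average_le:
  fixes f :: "nat \<Rightarrow> real"
  assumes "0 < m" "m \<le> M"
  shows "\<exists>g. inj_on g {..<m} \<and> g ` {..<m} \<subseteq> {..<M} \<and> (\<Sum>k<m. f (g k)) / real m \<le> (\<Sum>k<M. f k) / real M"
proof -
  obtain S where S: "S \<subseteq> {..<M}" "card S = m" "sum f S / real m \<le> sum f {..<M} / real M"
    using ex_subset_average_le[of "{..<M}" m f] assms by auto
  then have "finite S" using finite_subset by blast
  then obtain g where g: "bij_betw g {0..<m} S"
    using ex_bij_betw_nat_finite S(2) by blast
  then have "(\<Sum>k<m. f (g k)) = sum f S"
    unfolding lessThan_atLeast0 by (rule sum.reindex_bij_betw)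
  then show ?thesis
    using g S by (intro exI[of _ g]) (auto simp: bij_betw_def lessThan_atLeast0)
qed

text \<open>Expurgation in two levels: the best satellites are kept within each cloud, then the best
  clouds. The first codeword thus still depends on the first message only, and fewer competitors can
  only help the decoder.\<close>

lemma avg_error_mono_messages:
  assumes W: "is_channel W" and M: "0 < M1'" "M1' \<le> M1" "0 < M2'" "M2' \<le> M2"
  shows "\<exists>x1' x2'. avg_error W q n M1' M2' x1' x2' \<le> avg_error W q n M1 M2 x1 x2"
proof -
  define E where "E = msg_error W q n M1 M2 x1 x2"
  have "\<forall>i. \<exists>g. inj_on g {..<M2'} \<and> g ` {..<M2'} \<subseteq> {..<M2} \<and>
      (\<Sum>k<M2'. E i (g k)) / real M2' \<le> (\<Sum>k<M2. E i k) / real M2"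
    using ex_inj_average_le[OF M(3,4)] by blast
  then obtain g where g: "\<And>i. inj_on (g i) {..<M2'}" "\<And>i. g i ` {..<M2'} \<subseteq> {..<M2}"
      "\<And>i. (\<Sum>k<M2'. E i (g i k)) / real M2' \<le> (\<Sum>k<M2. E i k) / real M2" by metis
  obtain h where h: "inj_on h {..<M1'}" "h ` {..<M1'} \<subseteq> {..<M1}"
      "(\<Sum>k<M1'. (\<Sum>j<M2. E (h k) j) / real M2) / real M1' \<le> (\<Sum>i<M1. (\<Sum>j<M2. E i j) / real M2) / real M1"
    using ex_inj_average_le[OF M(1,2), of "\<lambda>i. (\<Sum>j<M2. E i j) / real M2"] by blast
  define x1' where "x1' k = x1 (h k)" for k
  define x2' where "x2' k l = x2 (h k) (g (h k) l)" for k l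
  have le: "msg_error W q n M1' M2' x1' x2' k l \<le> E (h k) (g (h k) l)" if kl: "k < M1'" "l < M2'" for k l
  proof -
    have dec: "decodes_correctly q n M1' M2' x1' x2' k l y"
      if d: "decodes_correctly q n M1 M2 x1 x2 (h k) (g (h k) l) y" for y
      unfolding decodes_correctly_def
    proof (intro allI impI)
      fix i' j' assume ij: "i' < M1'" "j' < M2'" "(i', j') \<noteq> (k, l)"
      have "(h i', g (h i') j') \<noteq> (h k, g (h k) l)"
        using ij kl h(1) g(1)[of "h k"] by (auto simp: inj_on_def)
      moreover have "h i' < M1" "g (h i') j' < M2" using ij h(2) g(2) by auto
      ultimately have "metric_score q n x1 x2 (h k) (g (h k) l) y > metric_score q n x1 x2 (h i') (g (h i') j') y"
        using d by (simp add: decodes_correctly_def)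
      then show "metric_score q n x1' x2' k l y > metric_score q n x1' x2' i' j' y"
        by (simp add: metric_score_def x1'_def x2'_def)
    qed
    show ?thesis
      unfolding msg_error_def E_def using W dec
      by (intro sum_mono) (auto simp: x1'_def x2'_def is_channel_def intro!: prod_nonneg)
  qed
  have "avg_error W q n M1' M2' x1' x2'
      \<le> 1 / (real M1' * real M2') * (\<Sum>k<M1'. \<Sum>l<M2'. E (h k) (g (h k) l))"
    unfolding avg_error_msg_error by (intro mult_left_mono sum_mono le) auto
  also have "\<dots> = (\<Sum>k<M1'. (\<Sum>l<M2'. E (h k) (g (h k) l)) / real M2') / real M1'"
    by (simp add: sum_divide_distrib[symmetric] mult_ac)
  also have "\<dots> \<le> (\<Sum>k<M1'. (\<Sum>j<M2. E (h k) j) / real M2) / real M1'"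
    by (intro divide_right_mono sum_mono g(3)) auto
  also have "\<dots> \<le> (\<Sum>i<M1. (\<Sum>j<M2. E i j) / real M2) / real M1" by (rule h(3))
  also have "\<dots> = avg_error W q n M1 M2 x1 x2"
    unfolding avg_error_msg_error E_def by (simp add: sum_divide_distrib[symmetric] mult_ac)
  finally show ?thesis by blast
qed

section \<open>Concatenation of codes\<close>

lemma Pi_pmf_prefix:
  "map_pmf (\<lambda>f t. if t < n then f t else d) (Pi_pmf {..<n + m} d p) = Pi_pmf {..<n::nat} d p"
  using Pi_pmf_subset[of "{..<n + m}" "{..<n}" d p] by simp

lemma Pi_pmf_suffix:
  "map_pmf (\<lambda>f t. if t < m then f (n + t) else d) (Pi_pmf {..<n + m} d p) = Pi_pmf {..<m::nat} d (\<lambda>t. p (n + t))"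
proof (induction m)
  case 0
  then show ?case by simp
next
  case (Suc m)
  let ?s = "\<lambda>m f t. if t < m then f (n + t) else d"
  have "map_pmf (?s (Suc m)) (Pi_pmf {..<n + Suc m} d p)
      = map_pmf (\<lambda>(y, f). ?s (Suc m) (f(n + m := y))) (pair_pmf (p (n + m)) (Pi_pmf {..<n + m} d p))"
    by (simp add: lessThan_Suc Pi_pmf_insert map_pmf_comp split_def)
  also have "\<dots> = map_pmf (\<lambda>(y, f). f(m := y)) (map_pmf (apsnd (?s m)) (pair_pmf (p (n + m)) (Pi_pmf {..<n + m} d p)))"
    by (auto simp: map_pmf_comp fun_eq_iff intro!: map_pmf_cong)
  also have "\<dots> = map_pmf (\<lambda>(y, f). f(m := y)) (pair_pmf (p (n + m)) (Pi_pmf {..<m} d (\<lambda>t. p (n + t))))"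
    by (simp only: pair_map_pmf2[symmetric] Suc)
  also have "\<dots> = Pi_pmf {..<Suc m} d (\<lambda>t. p (n + t))"
    by (simp add: lessThan_Suc Pi_pmf_insert)
  finally show ?case .
qed

lemma sum_mod_div:
  fixes G :: "nat \<Rightarrow> nat \<Rightarrow> real"
  shows "(\<Sum>i<a * b. G (i mod a) (i div a)) = (\<Sum>u<a. \<Sum>v<b. G u v)"
proof (cases "a = 0")
  case False
  have lt: "u + a * v < a * b" if "u < a" "v < b" for u v
  proof -
    have "u + a * v < a * Suc v" using that by simp
    also have "\<dots> \<le> a * b" using that by (intro mult_le_mono) auto
    finally show ?thesis .
  qed
  have "(\<Sum>i<a * b. G (i mod a) (i div a)) = (\<Sum>(u, v)\<in>{..<a} \<times> {..<b}. G u v)"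
    using False
    by (intro sum.reindex_bij_witness[where i = "\<lambda>(u, v). u + a * v" and j = "\<lambda>i. (i mod a, i div a)"])
       (auto simp: less_mult_imp_div_less mult.commute[of b a] lt)
  then show ?thesis by (simp add: sum.cartesian_product)
qed simp

text \<open>The two messages are split separately by \<open>mod\<close> and \<open>div\<close>, so
  the first encoder still sees only the first message. Scores add over the blocks, and correct
  decoding of both blocks implies correct decoding of the whole.\<close>

lemma avg_error_concat:
  fixes W :: "'a::finite \<Rightarrow> 'b::finite \<Rightarrow> 'c::finite \<Rightarrow> real"
  assumes W: "is_channel W" and M: "0 < A1" "0 < A2" "0 < B1" "0 < B2"
  shows "\<exists>x1 x2. avg_error W q (n + m) (A1 * B1) (A2 * B2) x1 x2
    \<le> avg_error W q n A1 A2 u1 u2 + avg_error W q m B1 B2 v1 v2"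
proof -
  obtain K where K: "\<And>a b c. pmf (K a b) c = W a b c"
    using is_channel_pmf[OF W] by blast
  define x1 where "x1 i t = (if t < n then u1 (i mod A1) t else v1 (i div A1) (t - n))" for i t
  define x2 where "x2 i j t = (if t < n then u2 (i mod A1) (j mod A2) t else v2 (i div A1) (j div A2) (t - n))" for i j t
  let ?eu = "msg_error W q n A1 A2 u1 u2" and ?ev = "msg_error W q m B1 B2 v1 v2"
  \<comment> \<open>Positions outside a block are reset to \<open>undefined\<close>, so that prefix
    and suffix follow the block channels.\<close>
  let ?pre = "\<lambda>y t. if t < n then y t else undefined" and ?suf = "\<lambda>y t. if t < m then y (n + t) else undefined"
  have split: "(\<Sum>t<n + m. g t) = (\<Sum>t<n. g t) + (\<Sum>t<m. g (n + t))" for g :: "nat \<Rightarrow> real"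
    by (induction m) (simp_all add: add.assoc)
  have score: "metric_score q (n + m) x1 x2 i j y
      = metric_score q n u1 u2 (i mod A1) (j mod A2) (?pre y)
      + metric_score q m v1 v2 (i div A1) (j div A2) (?suf y)" for i j y
    unfolding metric_score_def split by (simp add: x1_def x2_def)
  have le: "msg_error W q (n + m) (A1 * B1) (A2 * B2) x1 x2 i j
      \<le> ?eu (i mod A1) (j mod A2) + ?ev (i div A1) (j div A2)" if ij: "i < A1 * B1" "j < A2 * B2" for i j
  proof -
    let ?p = "seq_channel K (n + m) (x1 i) (x2 i j)"
    let ?Eu = "{y. \<not> decodes_correctly q n A1 A2 u1 u2 (i mod A1) (j mod A2) y}"
    let ?Ev = "{y. \<not> decodes_correctly q m B1 B2 v1 v2 (i div A1) (j div A2) y}"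
    have dec: "decodes_correctly q (n + m) (A1 * B1) (A2 * B2) x1 x2 i j y"
      if du: "decodes_correctly q n A1 A2 u1 u2 (i mod A1) (j mod A2) (?pre y)"
        and dv: "decodes_correctly q m B1 B2 v1 v2 (i div A1) (j div A2) (?suf y)" for y
      unfolding decodes_correctly_def
    proof (intro allI impI)
      fix i' j' assume ij': "i' < A1 * B1" "j' < A2 * B2" "(i', j') \<noteq> (i, j)"
      have lt: "i' mod A1 < A1" "j' mod A2 < A2" "i' div A1 < B1" "j' div A2 < B2"
        using ij' M by (auto simp: less_mult_imp_div_less mult.commute)
      let ?su = "\<lambda>i j. metric_score q n u1 u2 (i mod A1) (j mod A2) (?pre y)"
      let ?sv = "\<lambda>i j. metric_score q m v1 v2 (i div A1) (j div A2) (?suf y)"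
      have u: "(i' mod A1, j' mod A2) \<noteq> (i mod A1, j mod A2) \<Longrightarrow> ?su i' j' < ?su i j"
        using du lt by (simp add: decodes_correctly_def)
      have v: "(i' div A1, j' div A2) \<noteq> (i div A1, j div A2) \<Longrightarrow> ?sv i' j' < ?sv i j"
        using dv lt by (simp add: decodes_correctly_def)
      \<comment> \<open>A different message pair differs in at least one block, where it loses
        strictly; in the other block it coincides or loses as well.\<close>
      have "(i' mod A1, j' mod A2) \<noteq> (i mod A1, j mod A2) \<or> (i' div A1, j' div A2) \<noteq> (i div A1, j div A2)"
        using ij'(3) by (metis div_mult_mod_eq prod.inject)
      moreover have "?su i' j' \<le> ?su i j" using u by (cases "(i' mod A1, j' mod A2) = (i mod A1, j mod A2)") auto
      moreover have "?sv i' j' \<le> ?sv i j" using v by (cases "(i' div A1, j' div A2) = (i div A1, j div A2)") auto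
      ultimately have "?su i' j' + ?sv i' j' < ?su i j + ?sv i j" using u v by fastforce
      then show "metric_score q (n + m) x1 x2 i j y > metric_score q (n + m) x1 x2 i' j' y"
        unfolding score .
    qed
    have pre: "map_pmf ?pre ?p = seq_channel K n (u1 (i mod A1)) (u2 (i mod A1) (j mod A2))"
      unfolding seq_channel_def Pi_pmf_prefix by (intro Pi_pmf_cong) (auto simp: x1_def x2_def)
    have suf: "map_pmf ?suf ?p = seq_channel K m (v1 (i div A1)) (v2 (i div A1) (j div A2))"
      unfolding seq_channel_def Pi_pmf_suffix by (intro Pi_pmf_cong) (auto simp: x1_def x2_def)
    have "msg_error W q (n + m) (A1 * B1) (A2 * B2) x1 x2 i j \<le> measure_pmf.prob ?p (?pre -` ?Eu \<union> ?suf -` ?Ev)"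
      unfolding msg_error_prob[OF K] using dec by (intro measure_pmf.finite_measure_mono) auto
    also have "\<dots> \<le> measure_pmf.prob ?p (?pre -` ?Eu) + measure_pmf.prob ?p (?suf -` ?Ev)"
      by (intro measure_Un_le) auto
    also have "\<dots> = ?eu (i mod A1) (j mod A2) + ?ev (i div A1) (j div A2)"
      unfolding msg_error_prob[OF K] pre[symmetric] suf[symmetric] measure_map_pmf ..
    finally show ?thesis .
  qed
  have "avg_error W q (n + m) (A1 * B1) (A2 * B2) x1 x2
      \<le> 1 / (real (A1 * B1) * real (A2 * B2)) *
        (\<Sum>i<A1 * B1. \<Sum>j<A2 * B2. ?eu (i mod A1) (j mod A2) + ?ev (i div A1) (j div A2))"
    unfolding avg_error_msg_error by (intro mult_left_mono sum_mono le) auto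
  also have "(\<Sum>i<A1 * B1. \<Sum>j<A2 * B2. ?eu (i mod A1) (j mod A2) + ?ev (i div A1) (j div A2))
      = (\<Sum>i<A1. \<Sum>i'<B1. \<Sum>j<A2. \<Sum>j'<B2. ?eu i j + ?ev i' j')"
    using sum_mod_div[of "\<lambda>u v. ?eu s u + ?ev r v" A2 B2 for s r]
      sum_mod_div[of "\<lambda>s r. \<Sum>j<A2. \<Sum>j'<B2. ?eu s j + ?ev r j'" A1 B1] by simp
  also have "\<dots> = real B1 * real B2 * (\<Sum>i<A1. \<Sum>j<A2. ?eu i j) + real A1 * real A2 * (\<Sum>i<B1. \<Sum>j<B2. ?ev i j)"
    by (simp add: sum.distrib sum_distrib_left mult_ac)
  also have "1 / (real (A1 * B1) * real (A2 * B2)) * \<dots>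
      = avg_error W q n A1 A2 u1 u2 + avg_error W q m B1 B2 v1 v2"
    using M by (simp add: avg_error_msg_error field_simps)
  finally show ?thesis by blast
qed

section \<open>Message counts and mixing of rates\<close>

lemma num_msgs_ge: "2 powr (real n * R) \<le> real (num_msgs n R)"
  unfolding num_msgs_def by linarith

lemma num_msgs_le_iff: "num_msgs n R \<le> M \<longleftrightarrow> 2 powr (real n * R) \<le> real M"
  unfolding num_msgs_def by (simp add: nat_le_iff ceiling_le_iff)

lemma num_msgs_pos: "0 < num_msgs n R"
  by (simp add: num_msgs_def)

lemma num_msgs_mult:
  assumes "real n * T \<le> real k * R + real l * S"
  shows "num_msgs n T \<le> num_msgs k R * num_msgs l S"
proof -
  have "2 powr (real n * T) \<le> 2 powr (real k * R) * 2 powr (real l * S)"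
    using assms by (simp add: powr_add[symmetric])
  also have "\<dots> \<le> real (num_msgs k R) * real (num_msgs l S)"
    by (intro mult_mono num_msgs_ge) auto
  finally show ?thesis by (simp add: num_msgs_le_iff)
qed

text \<open>Truncation at 0 keeps the reduced rates admissible and moves each of them by at most
  \<open>e\<close>.\<close>

lemma closure_achievable:
  assumes T: "0 \<le> fst T" "0 \<le> snd T"
    and ach: "\<And>e. 0 < e \<Longrightarrow> achievable W q (max 0 (fst T - e), max 0 (snd T - e))"
  shows "T \<in> closure {R. achievable W q R}"
  unfolding closure_approachable
proof (intro allI impI)
  fix e :: real assume e: "0 < e"
  \<comment> \<open>With \<open>e / 3\<close> in each coordinate the distance is at most
    \<open>2 * e / 3\<close>, strictly below \<open>e\<close>.\<close>
  let ?R = "(max 0 (fst T - e / 3), max 0 (snd T - e / 3))"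
  have "dist ?R T \<le> dist (fst ?R) (fst T) + dist (snd ?R) (snd T)"
    unfolding dist_prod_def by (rule sqrt_sum_squares_le_sum) auto
  also have "\<dots> < e"
    using T e by (auto simp: dist_real_def)
  finally show "\<exists>y\<in>{R. achievable W q R}. dist y T < e"
    using ach[of "e / 3"] e by (intro bexI[of _ ?R]) auto
qed

lemma time_sharing:
  fixes W :: "'a::finite \<Rightarrow> 'b::finite \<Rightarrow> 'c::finite \<Rightarrow> real"
  assumes W: "is_channel W" and r: "achievable W q r" and s: "achievable W q s"
    and l: "0 < l" "l < 1"
  shows "l *\<^sub>R r + (1 - l) *\<^sub>R s \<in> closure {R. achievable W q R}"
proof (rule closure_achievable)
  have rs: "0 \<le> fst r" "0 \<le> snd r" "0 \<le> fst s" "0 \<le> snd s"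
    using r s by (auto simp: achievable_def)
  let ?T = "l *\<^sub>R r + (1 - l) *\<^sub>R s"
  show "0 \<le> fst ?T" "0 \<le> snd ?T" using rs l by auto
  fix e :: real assume e: "0 < e"
  let ?Te = "(max 0 (fst ?T - e), max 0 (snd ?T - e))"
  show "achievable W q ?Te"
    unfolding achievable_def
  proof (intro conjI allI impI)
    fix \<epsilon> :: real assume eps: "0 < \<epsilon>"
    obtain Nr where Nr: "\<And>n. n \<ge> Nr \<Longrightarrow> \<exists>x1 x2. avg_error W q n (num_msgs n (fst r)) (num_msgs n (snd r)) x1 x2 \<le> \<epsilon> / 2"
      using r eps unfolding achievable_def by (meson half_gt_zero)
    obtain Ns where Ns: "\<And>n. n \<ge> Ns \<Longrightarrow> \<exists>x1 x2. avg_error W q n (num_msgs n (fst s)) (num_msgs n (snd s)) x1 x2 \<le> \<epsilon> / 2"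
      using s eps unfolding achievable_def by (meson half_gt_zero)
    \<comment> \<open>The \<open>+ 1\<close> covers rounding down the length of the first block. The
      terms divided by \<open>e\<close> ensure that the rate of one lost symbol is absorbed by the
      loss \<open>e\<close>.\<close>
    define N where "N = nat \<lceil>(real Nr + 1) / l + real Ns / (1 - l) + fst r / e + snd r / e\<rceil>"
    show "\<exists>N. \<forall>n\<ge>N. \<exists>x1 x2. avg_error W q n (num_msgs n (fst ?Te)) (num_msgs n (snd ?Te)) x1 x2 \<le> \<epsilon>"
    proof (rule exI[of _ N], intro allI impI)
      fix n assume "n \<ge> N"
      then have "real n \<ge> (real Nr + 1) / l + real Ns / (1 - l) + fst r / e + snd r / e"
        unfolding N_def by linarith
      moreover have "(real Nr + 1) / l \<ge> 0" "real Ns / (1 - l) \<ge> 0" "fst r / e \<ge> 0" "snd r / e \<ge> 0"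
        using l e rs by auto
      ultimately have "real n \<ge> (real Nr + 1) / l" "real n \<ge> real Ns / (1 - l)" "real n \<ge> fst r / e" "real n \<ge> snd r / e"
        by linarith+
      then have n: "l * real n \<ge> real Nr + 1" "(1 - l) * real n \<ge> real Ns" "e * real n \<ge> fst r" "e * real n \<ge> snd r"
        using l e by (auto simp: field_simps)
      define k where "k = nat \<lfloor>l * real n\<rfloor>"
      have k1: "real k \<le> l * real n" "l * real n - 1 \<le> real k"
        unfolding k_def using l by (intro of_nat_floor) (simp, linarith)
      have "l * real n \<le> 1 * real n" using l by (intro mult_right_mono) auto
      then have kn: "k \<le> n" using k1 by linarith
      define m where "m = n - k"
      have nm: "n = k + m" using kn by (simp add: m_def)
      have m1: "(1 - l) * real n \<le> real m" using k1 kn by (simp add: m_def of_nat_diff algebra_simps)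
      have "k \<ge> Nr" "m \<ge> Ns" using k1 m1 n by linarith+
      then obtain u1 u2 v1 v2 where
        u: "avg_error W q k (num_msgs k (fst r)) (num_msgs k (snd r)) u1 u2 \<le> \<epsilon> / 2" and
        v: "avg_error W q m (num_msgs m (fst s)) (num_msgs m (snd s)) v1 v2 \<le> \<epsilon> / 2"
        using Nr Ns by meson
      \<comment> \<open>Rounding down costs the first code at most one symbol, hence at most
        \<open>x\<close> bits, while the second block is never shorter than
        \<open>(1 - l) * n\<close>.\<close>
      have rate: "real n * max 0 (l * x + (1 - l) * y - e) \<le> real k * x + real m * y"
        if "0 \<le> x" "0 \<le> y" "e * real n \<ge> x" for x y
      proof -
        have "(l * real n - 1) * x \<le> real k * x" "(1 - l) * real n * y \<le> real m * y"
          using k1 m1 that by (auto intro!: mult_right_mono)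
        then have "real n * (l * x + (1 - l) * y - e) \<le> real k * x + real m * y"
          using that by (simp add: algebra_simps)
        then show ?thesis using that by (simp add: max_def)
      qed
      have M: "num_msgs n (fst ?Te) \<le> num_msgs k (fst r) * num_msgs m (fst s)"
        "num_msgs n (snd ?Te) \<le> num_msgs k (snd r) * num_msgs m (snd s)"
        using rate rs n by (auto intro!: num_msgs_mult)
      obtain y1 y2 where "avg_error W q (k + m) (num_msgs k (fst r) * num_msgs m (fst s))
          (num_msgs k (snd r) * num_msgs m (snd s)) y1 y2
        \<le> avg_error W q k (num_msgs k (fst r)) (num_msgs k (snd r)) u1 u2
          + avg_error W q m (num_msgs m (fst s)) (num_msgs m (snd s)) v1 v2"
        using avg_error_concat[OF W num_msgs_pos num_msgs_pos num_msgs_pos num_msgs_pos] by blast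
      also have "\<dots> \<le> \<epsilon>" using u v by simp
      finally have y: "avg_error W q n (num_msgs k (fst r) * num_msgs m (fst s))
          (num_msgs k (snd r) * num_msgs m (snd s)) y1 y2 \<le> \<epsilon>" unfolding nm .
      then show "\<exists>x1 x2. avg_error W q n (num_msgs n (fst ?Te)) (num_msgs n (snd ?Te)) x1 x2 \<le> \<epsilon>"
        using avg_error_mono_messages[OF W num_msgs_pos M(1) num_msgs_pos M(2), of q n y1 y2]
        by (meson order_trans)
    qed
  qed auto
qed

text \<open>Mixtures of achievable pairs lie in the closure, and closedness extends this to limits.
  Weights 0 and 1 are separate because the block lengths in time sharing divide by both
  weights.\<close>

lemma convex_closure_achievable:
  fixes W :: "'a::finite \<Rightarrow> 'b::finite \<Rightarrow> 'c::finite \<Rightarrow> real"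
  assumes W: "is_channel W"
  shows "convex (closure {R. achievable W q R})"
proof (rule convexI)
  let ?A = "{R. achievable W q R}"
  fix x y :: "real \<times> real" and u v :: real
  assume xy: "x \<in> closure ?A" "y \<in> closure ?A" and uv: "0 \<le> u" "0 \<le> v" "u + v = 1"
  obtain X Y where X: "\<And>k. X k \<in> ?A" "X \<longlonglongrightarrow> x" and Y: "\<And>k. Y k \<in> ?A" "Y \<longlonglongrightarrow> y"
    using xy unfolding closure_sequential by blast
  consider "u = 0" | "u = 1" | "0 < u" "u < 1" using uv by fastforce
  then show "u *\<^sub>R x + v *\<^sub>R y \<in> closure ?A"
  proof cases
    case 3
    have "v = 1 - u" using uv by simp
    then have "u *\<^sub>R X k + v *\<^sub>R Y k \<in> closure ?A" for k
      using time_sharing[OF W _ _ 3] X(1) Y(1) by auto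
    then show ?thesis
      by (rule closed_sequentially[OF closed_closure, where f = "\<lambda>k. u *\<^sub>R X k + v *\<^sub>R Y k"]) (intro tendsto_intros X Y)
  qed (use xy uv in auto)
qed

section \<open>The superposition ensemble\<close>

lemma pmf_bind_Pair:
  fixes p :: "'a::finite pmf"
  shows "pmf (bind_pmf p (\<lambda>a. map_pmf (Pair a) (q a))) (a, b) = pmf p a * pmf (q a) b"
proof -
  have "pmf (map_pmf (Pair x) (q x)) (a, b) = (if x = a then pmf (q a) b else 0)" for x
  proof -
    have "Pair x -` {(a, b)} = (if x = a then {b} else {})" by auto
    then show ?thesis by (simp add: pmf_map measure_pmf_single)
  qed
  then have "pmf (bind_pmf p (\<lambda>a. map_pmf (Pair a) (q a))) (a, b)
      = measure_pmf.expectation p (\<lambda>x. if x = a then pmf (q a) b else 0)"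
    by (simp add: pmf_bind)
  also have "\<dots> = (\<Sum>x\<in>{a}. (if x = a then pmf (q a) b else 0) * pmf p x)"
    by (rule integral_measure_pmf_real) (auto split: if_splits)
  finally show ?thesis by (simp add: mult.commute)
qed

lemma margY_etype: "margY (etype n s v w) c = real (card {t\<in>{..<n}. w t = c}) / real n"
proof -
  have "margY (etype n s v w) c = (\<Sum>a\<in>UNIV. etype2 n s w a c)"
    unfolding marg1Y_etype[symmetric, where v = v] by (simp add: margY_def marg1Y_def)
  also have "\<dots> = (\<Sum>t<n. of_bool (w t = c)) / real n"
    unfolding etype2_sum by (subst sum_divide_distrib[symmetric], subst sum.swap) (simp add: sum_of_bool_conj)
  also have "(\<Sum>t<n. of_bool (w t = c)) = real (card {t\<in>{..<n}. w t = c})"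
    by (simp add: sum.inter_filter[symmetric] of_bool_def)
  finally show ?thesis .
qed

text \<open>One constant serves all four quantities: its summand 1 handles the marginal distances,
  and its summand \<open>\<bar>q a b c\<bar>\<close> the expected metric.\<close>

lemma dev_le_pointwise:
  fixes f P q :: "'a::finite \<Rightarrow> 'b::finite \<Rightarrow> 'c::finite \<Rightarrow> real"
  assumes le: "\<And>a b c. \<bar>f a b c - P a b c\<bar> \<le> e"
  defines "C \<equiv> (\<Sum>a\<in>UNIV. \<Sum>b\<in>UNIV. \<Sum>c\<in>UNIV. 1 + \<bar>q a b c\<bar>)"
  shows "dev12 P f \<le> C * e" "dev1Y P f \<le> C * e" "devY P f \<le> C * e"
    "expect_q f q \<ge> expect_q P q - C * e"
proof -
  have e: "0 \<le> e" using le[of undefined undefined undefined] by linarith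
  let ?S = "\<Sum>a\<in>UNIV. \<Sum>b\<in>UNIV. \<Sum>c\<in>UNIV. \<bar>f a b c - P a b c\<bar>"
  have S: "?S \<le> C * e"
  proof -
    have "\<bar>f a b c - P a b c\<bar> \<le> (1 + \<bar>q a b c\<bar>) * e" for a b c
      using mult_mono[of 1 "1 + \<bar>q a b c\<bar>" "\<bar>f a b c - P a b c\<bar>" e] le[of a b c] e by auto
    then show ?thesis
      unfolding C_def sum_distrib_right by (intro sum_mono)
  qed
  have "dev12 P f \<le> ?S"
    unfolding dev12_def marg12_def sum_subtractf[symmetric] by (intro sum_mono sum_abs)
  then show "dev12 P f \<le> C * e" using S by simp
  have "dev1Y P f \<le> (\<Sum>a\<in>UNIV. \<Sum>c\<in>UNIV. \<Sum>b\<in>UNIV. \<bar>f a b c - P a b c\<bar>)"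
    unfolding dev1Y_def marg1Y_def sum_subtractf[symmetric] by (intro sum_mono sum_abs)
  also have "\<dots> = ?S" by (intro sum.cong refl sum.swap)
  finally show "dev1Y P f \<le> C * e" using S by simp
  have "devY P f \<le> (\<Sum>c\<in>UNIV. \<Sum>a\<in>UNIV. \<Sum>b\<in>UNIV. \<bar>f a b c - P a b c\<bar>)"
    unfolding devY_def margY_def sum_subtractf[symmetric]
    by (intro sum_mono order_trans[OF sum_abs]) simp
  also have "\<dots> = ?S" by (subst sum.swap, intro sum.cong refl sum.swap)
  finally show "devY P f \<le> C * e" using S by simp
  have "expect_q P q - expect_q f q = (\<Sum>a\<in>UNIV. \<Sum>b\<in>UNIV. \<Sum>c\<in>UNIV. (P a b c - f a b c) * q a b c)"
    by (simp add: expect_q_def sum_subtractf left_diff_distrib)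
  also have "\<dots> \<le> (\<Sum>a\<in>UNIV. \<Sum>b\<in>UNIV. \<Sum>c\<in>UNIV. (1 + \<bar>q a b c\<bar>) * e)"
  proof (intro sum_mono)
    fix a b c
    have "(P a b c - f a b c) * q a b c \<le> \<bar>P a b c - f a b c\<bar> * \<bar>q a b c\<bar>"
      by (simp add: abs_mult[symmetric])
    also have "\<dots> \<le> e * (1 + \<bar>q a b c\<bar>)"
      using le[of a b c] e by (intro mult_mono) auto
    finally show "(P a b c - f a b c) * q a b c \<le> (1 + \<bar>q a b c\<bar>) * e" by (simp add: mult.commute)
  qed
  also have "\<dots> = C * e" by (simp add: C_def sum_distrib_right)
  finally show "expect_q f q \<ge> expect_q P q - C * e" by simp
qed

lemma sum_one_plus_abs_pos:
  fixes q :: "'a::finite \<Rightarrow> 'b::finite \<Rightarrow> 'c::finite \<Rightarrow> real"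
  shows "0 < (\<Sum>a\<in>UNIV. \<Sum>b\<in>UNIV. \<Sum>c\<in>UNIV. 1 + \<bar>q a b c\<bar>)"
  by (intro sum_pos) (auto intro: add_pos_nonneg)

text \<open>The input law is factored in product form, so that \<open>P21 a\<close> may be anything
  at a letter \<open>a\<close> of mass zero.\<close>

locale superposition_ensemble =
  fixes W q :: "'a::finite \<Rightarrow> 'b::finite \<Rightarrow> 'c::finite \<Rightarrow> real" and p :: "'a \<Rightarrow> 'b \<Rightarrow> real"
    and K :: "'a \<Rightarrow> 'b \<Rightarrow> 'c pmf" and P1 :: "'a pmf" and P21 :: "'a \<Rightarrow> 'b pmf"
    and n :: nat and \<eta> :: real
  assumes K: "\<And>a b c. pmf (K a b) c = W a b c"
    and P12: "\<And>a b. pmf P1 a * pmf (P21 a) b = p a b"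
    and n: "0 < n"
begin

definition "P = (\<lambda>a b c. p a b * W a b c)"

definition "Q1 = Pi_pmf {..<n} undefined (\<lambda>_. P1)"
definition "Q2 u = Pi_pmf {..<n} undefined (\<lambda>t. P21 (u t))"

text \<open>The codeword laws are parameters, because the same construction is compared for the
  i.i.d. and the conditioned ensemble.\<close>

definition joint_law where
  "joint_law r1 r2 = bind_pmf r1 (\<lambda>u. bind_pmf (r2 u) (\<lambda>v. map_pmf (\<lambda>w. (u, v, w)) (seq_channel K n u v)))"

definition score :: "(nat \<Rightarrow> 'a) \<Rightarrow> (nat \<Rightarrow> 'b) \<Rightarrow> (nat \<Rightarrow> 'c) \<Rightarrow> real" where
  "score u v w = (\<Sum>t<n. q (u t) (v t) (w t))"

text \<open>Collects what a competitor can inherit: a satellite of the same cloud takes over the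
  marginal of centre and output, another cloud the marginal of the output, and each winner the
  expected metric.\<close>

definition typical where
  "typical u v w \<longleftrightarrow> (let f = etype n u v w in dev12 P f \<le> \<eta> \<and> dev1Y P f \<le> \<eta> \<and> devY P f \<le> \<eta> \<and>
     expect_q f q \<ge> expect_q P q - \<eta>)"

definition typical12 where
  "typical12 u = {v. (\<Sum>a\<in>UNIV. \<Sum>b\<in>UNIV. \<bar>etype2 n u v a b - marg12 P a b\<bar>) \<le> \<eta>}"

text \<open>With this choice of typical centres, conditional typicality of the satellites holds by
  definition, and Markov's inequality shows that most centres are typical.\<close>

definition typical1 where
  "typical1 = {u. measure_pmf.prob (Q2 u) (typical12 u) \<ge> 1 / 2}"

definition "p1 = cond_pmf Q1 typical1"
definition "p2 u = cond_pmf (Q2 u) (typical12 u)"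

lemma dev12_etype: "dev12 P (etype n u v w) \<le> \<eta> \<longleftrightarrow> v \<in> typical12 u"
  by (simp add: dev12_def marg12_etype typical12_def)

lemma score_eq: "score u v w = real n * expect_q (etype n u v w) q"
  unfolding score_def by (rule sum_eq_etype)

lemma prob_not_typical_iid:
  assumes \<eta>: "0 < \<eta>"
  defines "C \<equiv> (\<Sum>a\<in>UNIV. \<Sum>b\<in>UNIV. \<Sum>c\<in>UNIV. 1 + \<bar>q a b c\<bar>)"
  shows "measure_pmf.prob (joint_law Q1 Q2) {(u, v, w). \<not> typical u v w}
    \<le> real CARD('a \<times> 'b \<times> 'c) * (2 * exp (- 2 * real n * (\<eta> / C)\<^sup>2))"
proof -
  have C: "C > 0" unfolding C_def by (rule sum_one_plus_abs_pos)
  \<comment> \<open>The single-letter law of input pair and output. Splitting off one coordinate at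
    a time twice shows that the transmitted triple is i.i.d. with this law.\<close>
  define T where "T = bind_pmf P1 (\<lambda>a. map_pmf (Pair a) (bind_pmf (P21 a) (\<lambda>b. map_pmf (Pair b) (K a b))))"
  have pmfT: "pmf T (a, b, c) = P a b c" for a b c
    by (simp add: T_def pmf_bind_Pair K P12 P_def flip: mult.assoc)
  let ?z = "\<lambda>(u, v, w) t. if t < n then (u t, if t < n then (v t, w t) else undefined) else undefined"
  have "Pi_pmf {..<n} undefined (\<lambda>_. T) = map_pmf ?z (joint_law Q1 Q2)"
    unfolding T_def joint_law_def Q1_def Q2_def seq_channel_def
    unfolding Pi_pmf_pair_conv[where ?d1.0 = undefined and ?d2.0 = undefined]
    by (simp add: map_bind_pmf map_pmf_comp)
  then have bound: "measure_pmf.prob (map_pmf ?z (joint_law Q1 Q2))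
      {z. \<exists>x. \<bar>real (card {t\<in>{..<n}. z t = x}) / real n - pmf T x\<bar> \<ge> \<eta> / C}
      \<le> real CARD('a \<times> 'b \<times> 'c) * (2 * exp (- 2 * real n * (\<eta> / C)\<^sup>2))"
    using iid_concentration[of "\<eta> / C" n undefined T] \<eta> C n by simp
  have sub: "{(u, v, w). \<not> typical u v w}
    \<subseteq> ?z -` {z. \<exists>x. \<bar>real (card {t\<in>{..<n}. z t = x}) / real n - pmf T x\<bar> \<ge> \<eta> / C}"
  proof clarify
    fix u :: "nat \<Rightarrow> 'a" and v :: "nat \<Rightarrow> 'b" and w :: "nat \<Rightarrow> 'c"
    assume "\<not> typical u v w"
    \<comment> \<open>Contrapositive of the entrywise estimate: deviations below
      \<open>\<eta> / C\<close> in all entries would make the triple typical.\<close>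
    then obtain a b c where "\<bar>etype n u v w a b c - P a b c\<bar> \<ge> \<eta> / C"
      using dev_le_pointwise[of "etype n u v w" P "\<eta> / C" q] C unfolding typical_def Let_def C_def[symmetric]
      by (metis less_eq_real_def linorder_not_le nonzero_mult_div_cancel_left order_less_irrefl times_divide_eq_right)
    moreover have "{t\<in>{..<n}. ?z (u, v, w) t = (a, b, c)} = {t\<in>{..<n}. u t = a \<and> v t = b \<and> w t = c}"
      by auto
    ultimately have "\<bar>real (card {t\<in>{..<n}. ?z (u, v, w) t = (a, b, c)}) / real n - pmf T (a, b, c)\<bar> \<ge> \<eta> / C"
      by (simp only: etype_def pmfT)
    then show "(u, v, w) \<in> ?z -` {z. \<exists>x. \<bar>real (card {t\<in>{..<n}. z t = x}) / real n - pmf T x\<bar> \<ge> \<eta> / C}"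
      unfolding vimage_def mem_Collect_eq by blast
  qed
  show ?thesis
    by (rule order_trans[OF measure_pmf.finite_measure_mono[OF sub] bound[unfolded measure_map_pmf]]) simp
qed

context
  fixes e0 :: real
  assumes e0: "measure_pmf.prob (joint_law Q1 Q2) {(u, v, w). \<not> typical u v w} \<le> e0" "e0 \<le> 1 / 4"
begin

lemma prob_typical1: "measure_pmf.prob Q1 typical1 \<ge> 1 / 2"
proof -
  let ?g = "\<lambda>u. measure_pmf.prob (Q2 u) (- typical12 u)"
  have "map_pmf (\<lambda>(u, v, w). (u, v)) (joint_law Q1 Q2) = bind_pmf Q1 (\<lambda>u. map_pmf (Pair u) (Q2 u))"
    by (simp add: joint_law_def map_bind_pmf map_pmf_comp map_pmf_def[symmetric])
  then have "measure_pmf.expectation Q1 ?g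
      = measure_pmf.prob (map_pmf (\<lambda>(u, v, w). (u, v)) (joint_law Q1 Q2)) {(u, v). v \<notin> typical12 u}"
    by (simp add: measure_bind_pmf_expectation vimage_def Compl_eq del: measure_map_pmf)
       (simp add: vimage_def)
  also have "\<dots> \<le> measure_pmf.prob (joint_law Q1 Q2) {(u, v, w). \<not> typical u v w}"
    unfolding measure_map_pmf
    by (intro measure_pmf.finite_measure_mono) (auto simp: typical_def Let_def dev12_etype)
  finally have g: "measure_pmf.expectation Q1 ?g \<le> 1 / 4" using e0 by simp
  \<comment> \<open>Outside \<open>typical1\<close> the conditional failure probability exceeds 1/2,
    while its mean is at most 1/4; this is where the bound on \<open>e0\<close> is spent.\<close>
  have "measure_pmf.expectation Q1 (\<lambda>u. 1 / 2 * indicator (- typical1) u) \<le> measure_pmf.expectation Q1 ?g"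
  proof (intro integral_mono)
    show "integrable (measure_pmf Q1) (\<lambda>u. 1 / 2 * indicator (- typical1) u :: real)"
      by (rule measure_pmf.integrable_const_bound[where B = 1]) (auto simp: indicator_def)
    show "integrable (measure_pmf Q1) ?g"
      by (rule measure_pmf.integrable_const_bound[where B = 1]) auto
    fix u
    show "1 / 2 * indicator (- typical1) u \<le> ?g u"
      by (auto simp: indicator_def typical1_def measure_pmf.prob_compl[of "typical12 u" "Q2 u", simplified] Compl_eq_Diff_UNIV)
  qed
  also have "measure_pmf.expectation Q1 (\<lambda>u. 1 / 2 * indicator (- typical1) u)
      = 1 / 2 * measure_pmf.prob Q1 (- typical1)" by simp
  finally have "measure_pmf.prob Q1 (- typical1) \<le> 1 / 2" using g by simp
  then show ?thesis
    by (simp add: Compl_eq_Diff_UNIV measure_pmf.prob_compl[of typical1 Q1, simplified])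
qed

lemma p1_le: "pmf p1 u \<le> 2 * pmf Q1 u"
  unfolding p1_def by (rule pmf_cond_le[OF prob_typical1])

lemma set_p1: "u \<in> set_pmf p1 \<Longrightarrow> u \<in> typical1"
  unfolding p1_def by (simp add: set_cond_pmf_of_prob[OF prob_typical1])

lemma p2_le: "u \<in> set_pmf p1 \<Longrightarrow> pmf (p2 u) v \<le> 2 * pmf (Q2 u) v"
  unfolding p2_def using set_p1[of u] by (intro pmf_cond_le) (simp add: typical1_def)

lemma set_p2: "u \<in> set_pmf p1 \<Longrightarrow> v \<in> set_pmf (p2 u) \<Longrightarrow> v \<in> typical12 u"
  using set_p1[of u] unfolding p2_def by (subst (asm) set_cond_pmf_of_prob) (auto simp: typical1_def)

text \<open>One factor 2 comes from the centre and one from the satellite; the kernel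
  \<open>h\<close>, such as the channel, is left unchanged.\<close>

lemma prob_p1_p2_le:
  "measure_pmf.prob (bind_pmf p1 (\<lambda>u. bind_pmf (p2 u) (h u))) A
    \<le> 4 * measure_pmf.prob (bind_pmf Q1 (\<lambda>u. bind_pmf (Q2 u) (h u))) A"
proof (rule prob_le_of_pmf_le)
  fix x
  have "pmf (bind_pmf (p2 u) (h u)) x \<le> 2 * pmf (bind_pmf (Q2 u) (h u)) x" if "u \<in> set_pmf p1" for u
    using pmf_bind_le_of_pmf_le[where c = 2 and d = 1 and f = "h u" and g = "h u", OF p2_le[OF that]] by simp
  then show "pmf (bind_pmf p1 (\<lambda>u. bind_pmf (p2 u) (h u))) x
      \<le> 4 * pmf (bind_pmf Q1 (\<lambda>u. bind_pmf (Q2 u) (h u))) x"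
    using pmf_bind_le_of_pmf_le[where c = 2 and d = 2 and f = "\<lambda>u. bind_pmf (p2 u) (h u)"
        and g = "\<lambda>u. bind_pmf (Q2 u) (h u)", OF p1_le] by simp
qed simp

lemma prob_not_typical: "measure_pmf.prob (joint_law p1 p2) {(u, v, w). \<not> typical u v w} \<le> 4 * e0"
  using prob_p1_p2_le[of "\<lambda>u v. map_pmf (\<lambda>w. (u, v, w)) (seq_channel K n u v)"] e0
  unfolding joint_law_def by (meson mult_left_mono order_trans zero_le_numeral)

definition types :: "('a \<Rightarrow> 'b \<Rightarrow> 'c \<Rightarrow> real) set" where
  "types = {f. \<exists>u v w. f = etype n u v w}"

lemma finite_types: "finite types" and card_types: "real (card types) \<le> real (n + 1) ^ CARD('a \<times> 'b \<times> 'c)"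
  unfolding types_def by (rule card_types_le)+

lemma is_dist3_types: "f \<in> types \<Longrightarrow> is_dist3 f"
  using is_dist3_etype[OF n] by (auto simp: types_def)

text \<open>The competitor shares centre and output with the transmitted triple, so that marginal is
  inherited exactly. Conditioning bounds the deviation of the pair marginal, and the winning score
  bounds the expected metric.\<close>

lemma prob_same_cloud_le:
  assumes uvw: "u \<in> set_pmf p1" "typical u v w"
    and slack: "\<And>f. is_dist3 f \<Longrightarrow> dev12 P f \<le> \<eta> \<Longrightarrow> dev1Y P f \<le> \<eta> \<Longrightarrow>
      expect_q f q \<ge> expect_q P q - \<eta> \<Longrightarrow> I \<le> MI_X2_Y_given_X1 f"
  shows "measure_pmf.prob (p2 u) {v'. score u v' w \<ge> score u v w}
    \<le> real (n + 1) ^ CARD('a \<times> 'b \<times> 'c) * (2 * 2 powr (- real n * I))"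
proof -
  define F where "F = {f \<in> types. dev12 P f \<le> \<eta> \<and> dev1Y P f \<le> \<eta> \<and> expect_q f q \<ge> expect_q P q - \<eta>}"
  have finF: "finite F" using finite_types by (simp add: F_def)
  \<comment> \<open>The support of \<open>p2 u\<close> enters because only there is the competitor
    known to be typical with its centre.\<close>
  have "{v'. score u v' w \<ge> score u v w} \<inter> set_pmf (p2 u) \<subseteq> (\<Union>f\<in>F. {v'. etype n u v' w = f})"
  proof clarify
    fix v' assume v': "score u v' w \<ge> score u v w" "v' \<in> set_pmf (p2 u)"
    have "expect_q (etype n u v' w) q \<ge> expect_q (etype n u v w) q"
      using v'(1) n by (simp add: score_eq)
    moreover have "dev12 P (etype n u v' w) \<le> \<eta>"
      using set_p2[OF uvw(1) v'(2)] by (simp add: dev12_etype)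
    moreover have "dev1Y P (etype n u v' w) = dev1Y P (etype n u v w)"
      by (simp add: dev1Y_def marg1Y_etype)
    ultimately have "etype n u v' w \<in> F"
      using uvw(2) by (auto simp: F_def types_def typical_def Let_def)
    then show "v' \<in> (\<Union>f\<in>F. {v'. etype n u v' w = f})" by simp
  qed
  then have "measure_pmf.prob (p2 u) {v'. score u v' w \<ge> score u v w}
      \<le> measure_pmf.prob (p2 u) (\<Union>f\<in>F. {v'. etype n u v' w = f})"
    by (subst measure_Int_set_pmf[symmetric]) (rule measure_pmf.finite_measure_mono, auto)
  also have "\<dots> \<le> (\<Sum>f\<in>F. measure_pmf.prob (p2 u) {v'. etype n u v' w = f})"
    by (rule measure_pmf.finite_measure_subadditive_finite[OF finF]) auto
  also have "\<dots> \<le> (\<Sum>f\<in>F. 2 * 2 powr (- real n * I))"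
  proof (intro sum_mono)
    fix f assume f: "f \<in> F"
    have "measure_pmf.prob (p2 u) {v'. etype n u v' w = f} \<le> 2 * measure_pmf.prob (Q2 u) {v'. etype n u v' w = f}"
      using p2_le[OF uvw(1)] by (intro prob_le_of_pmf_le) auto
    also have "\<dots> \<le> 2 * 2 powr (- real n * MI_X2_Y_given_X1 f)"
      unfolding Q2_def by (intro mult_left_mono prob_type_le n) auto
    also have "\<dots> \<le> 2 * 2 powr (- real n * I)"
      using slack[of f] f is_dist3_types[of f] by (simp add: F_def mult_left_mono)
    finally show "measure_pmf.prob (p2 u) {v'. etype n u v' w = f} \<le> 2 * 2 powr (- real n * I)" .
  qed
  also have "\<dots> = real (card F) * (2 * 2 powr (- real n * I))" by simp
  also have "\<dots> \<le> real (n + 1) ^ CARD('a \<times> 'b \<times> 'c) * (2 * 2 powr (- real n * I))"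
  proof (rule mult_right_mono)
    have "card F \<le> card types" using finite_types by (intro card_mono) (auto simp: F_def)
    then show "real (card F) \<le> real (n + 1) ^ CARD('a \<times> 'b \<times> 'c)" using card_types by linarith
  qed simp
  finally show ?thesis .
qed

text \<open>The constants are 2 where only the centre was conditioned and 4 where centre and
  satellite were.\<close>

lemma prob_cloud_type_le:
  assumes f: "is_dist3 f"
  shows "measure_pmf.prob (cloud_pmf p1 p2 M) {(u, V). \<exists>j<M. etype n u (V j) w = f}
      \<le> 2 * 2 powr (- real n * MI_X1_Y f)"
    and "measure_pmf.prob (cloud_pmf p1 p2 M) {(u, V). \<exists>j<M. etype n u (V j) w = f}
      \<le> 4 * real M * 2 powr (- real n * MI_X1X2_Y f)"
proof -
  let ?E = "{(u, V). \<exists>j<M. etype n u (V j) w = f}"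
  have "map_pmf fst (cloud_pmf p1 p2 M) = p1"
    by (simp add: cloud_pmf_def map_bind_pmf map_pmf_comp bind_return_pmf')
  then have "measure_pmf.prob p1 {u. etype2 n u w = marg1Y f}
      = measure_pmf.prob (cloud_pmf p1 p2 M) (fst -` {u. etype2 n u w = marg1Y f})"
    by (metis measure_map_pmf)
  moreover have "measure_pmf.prob (cloud_pmf p1 p2 M) ?E
      \<le> measure_pmf.prob (cloud_pmf p1 p2 M) (fst -` {u. etype2 n u w = marg1Y f})"
    by (intro measure_pmf.finite_measure_mono) (auto simp: marg1Y_etype)
  moreover have "measure_pmf.prob p1 {u. etype2 n u w = marg1Y f} \<le> 2 * measure_pmf.prob Q1 {u. etype2 n u w = marg1Y f}"
    using p1_le by (intro prob_le_of_pmf_le) auto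
  moreover have "measure_pmf.prob Q1 {u. etype2 n u w = marg1Y f} \<le> 2 powr (- real n * MI_X1_Y f)"
    unfolding Q1_def by (rule prob_type_X1_le[OF n f])
  ultimately show "measure_pmf.prob (cloud_pmf p1 p2 M) ?E \<le> 2 * 2 powr (- real n * MI_X1_Y f)"
    by linarith
  have comp: "measure_pmf.prob (cloud_pmf p1 p2 M) {(u, V). etype n u (V j) w = f}
      \<le> 4 * 2 powr (- real n * MI_X1X2_Y f)" if j: "j < M" for j
  proof -
    have "measure_pmf.prob (cloud_pmf p1 p2 M) {(u, V). etype n u (V j) w = f}
        = measure_pmf.prob (map_pmf (\<lambda>c. (fst c, snd c j)) (cloud_pmf p1 p2 M)) {(u, v). etype n u v w = f}"
      by (simp add: vimage_def split_def)
    also have "\<dots> \<le> 4 * measure_pmf.prob (bind_pmf Q1 (\<lambda>u. map_pmf (Pair u) (Q2 u))) {(u, v). etype n u v w = f}"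
      unfolding map_cloud_component[OF j] unfolding map_pmf_def by (rule prob_p1_p2_le)
    also have "\<dots> \<le> 4 * 2 powr (- real n * MI_X1X2_Y f)"
      unfolding Q1_def Q2_def by (intro mult_left_mono prob_type_X1X2_le n f) auto
    finally show ?thesis .
  qed
  have "?E = (\<Union>j\<in>{..<M}. {(u, V). etype n u (V j) w = f})" by auto
  also have "measure_pmf.prob (cloud_pmf p1 p2 M) \<dots>
      \<le> (\<Sum>j<M. measure_pmf.prob (cloud_pmf p1 p2 M) {(u, V). etype n u (V j) w = f})"
    by (rule measure_pmf.finite_measure_subadditive_finite) auto
  also have "\<dots> \<le> (\<Sum>j<M. 4 * 2 powr (- real n * MI_X1X2_Y f))"
    by (intro sum_mono comp) auto
  finally show "measure_pmf.prob (cloud_pmf p1 p2 M) ?E \<le> 4 * real M * 2 powr (- real n * MI_X1X2_Y f)"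
    by simp
qed

text \<open>The number \<open>L\<close> of competing clouds stays inside the bound for a single
  type, because which of the two estimates is the useful one varies with \<open>f\<close>.\<close>

lemma prob_other_cloud_le:
  assumes uvw: "typical u v w"
    and bound: "\<And>f. is_dist3 f \<Longrightarrow> dev12 P f \<le> \<eta> \<Longrightarrow> devY P f \<le> \<eta> \<Longrightarrow>
      expect_q f q \<ge> expect_q P q - \<eta> \<Longrightarrow>
      L * min (2 * 2 powr (- real n * MI_X1_Y f)) (4 * real M * 2 powr (- real n * MI_X1X2_Y f)) \<le> B"
    and L: "0 \<le> L"
  shows "L * measure_pmf.prob (cloud_pmf p1 p2 M) {(u', V). \<exists>j<M. score u' (V j) w \<ge> score u v w}
    \<le> real (n + 1) ^ CARD('a \<times> 'b \<times> 'c) * B"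
proof -
  define F where "F = {f \<in> types. dev12 P f \<le> \<eta> \<and> devY P f \<le> \<eta> \<and> expect_q f q \<ge> expect_q P q - \<eta>}"
  have finF: "finite F" using finite_types by (simp add: F_def)
  let ?c = "cloud_pmf p1 p2 M" and ?E = "\<lambda>f. {(u', V). \<exists>j<M. etype n u' (V j) w = f}"
  have uvwF: "etype n u v w \<in> F"
    using uvw by (auto simp: F_def types_def typical_def Let_def)
  have "{(u', V). \<exists>j<M. score u' (V j) w \<ge> score u v w} \<inter> set_pmf ?c \<subseteq> (\<Union>f\<in>F. ?E f)"
  proof clarify
    fix u' V j
    assume j: "j < M" "score u' (V j) w \<ge> score u v w" and c: "(u', V) \<in> set_pmf ?c"
    have "expect_q (etype n u' (V j) w) q \<ge> expect_q (etype n u v w) q"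
      using j(2) n by (simp add: score_eq)
    moreover have "dev12 P (etype n u' (V j) w) \<le> \<eta>"
      using set_p2[of u' "V j"] set_cloud_pmf[OF c j(1)] by (simp add: dev12_etype)
    moreover have "devY P (etype n u' (V j) w) = devY P (etype n u v w)"
      by (simp add: devY_def margY_etype)
    ultimately have "etype n u' (V j) w \<in> F"
      using uvw by (auto simp: F_def types_def typical_def Let_def)
    then show "(u', V) \<in> (\<Union>f\<in>F. ?E f)" using j(1) by auto
  qed
  then have "measure_pmf.prob ?c {(u', V). \<exists>j<M. score u' (V j) w \<ge> score u v w}
      \<le> measure_pmf.prob ?c (\<Union>f\<in>F. ?E f)"
    by (subst measure_Int_set_pmf[symmetric]) (rule measure_pmf.finite_measure_mono, auto)
  also have "\<dots> \<le> (\<Sum>f\<in>F. measure_pmf.prob ?c (?E f))"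
    by (rule measure_pmf.finite_measure_subadditive_finite[OF finF]) auto
  finally have "L * measure_pmf.prob ?c {(u', V). \<exists>j<M. score u' (V j) w \<ge> score u v w}
      \<le> (\<Sum>f\<in>F. L * measure_pmf.prob ?c (?E f))"
    using L by (simp add: mult_left_mono sum_distrib_left[symmetric])
  also have "\<dots> \<le> (\<Sum>f\<in>F. B)"
  proof (intro sum_mono)
    fix f assume f: "f \<in> F"
    then have "L * measure_pmf.prob ?c (?E f)
        \<le> L * min (2 * 2 powr (- real n * MI_X1_Y f)) (4 * real M * 2 powr (- real n * MI_X1X2_Y f))"
      using is_dist3_types[of f] by (intro mult_left_mono L min.boundedI prob_cloud_type_le) (auto simp: F_def)
    also have "\<dots> \<le> B" using f is_dist3_types[of f] by (intro bound) (auto simp: F_def)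
    finally show "L * measure_pmf.prob ?c (?E f) \<le> B" .
  qed
  also have "\<dots> = real (card F) * B" by simp
  also have "\<dots> \<le> real (n + 1) ^ CARD('a \<times> 'b \<times> 'c) * B"
  proof (rule mult_right_mono)
    have "card F \<le> card types" using finite_types by (intro card_mono) (auto simp: F_def)
    then show "real (card F) \<le> real (n + 1) ^ CARD('a \<times> 'b \<times> 'c)" using card_types by linarith
    \<comment> \<open>The transmitted type itself lies in \<open>F\<close>; this shows
      \<open>0 \<le> B\<close>, so that the cardinality of \<open>F\<close> may be enlarged to the
      polynomial.\<close>
    have "0 \<le> L * min (2 * 2 powr (- real n * MI_X1_Y (etype n u v w)))
        (4 * real M * 2 powr (- real n * MI_X1X2_Y (etype n u v w)))"
      using L by (intro mult_nonneg_nonneg) auto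
    also have "\<dots> \<le> B"
      using uvwF is_dist3_types by (intro bound) (auto simp: F_def)
    finally show "0 \<le> B" .
  qed
  finally show ?thesis .
qed

lemma code_exists:
  assumes M: "0 < M1" "0 < M2" and e: "0 < e" "4 * e0 \<le> e"
    and same_cloud: "\<And>u v w. u \<in> set_pmf p1 \<Longrightarrow> typical u v w \<Longrightarrow>
        real (M2 - 1) * measure_pmf.prob (p2 u) {v'. score u v' w \<ge> score u v w} \<le> e"
    and other_cloud: "\<And>u v w. typical u v w \<Longrightarrow>
        real (M1 - 1) * measure_pmf.prob (cloud_pmf p1 p2 M2)
          {(u', V). \<exists>j<M2. score u' (V j) w \<ge> score u v w} \<le> e"
  shows "\<exists>x1 x2. avg_error W q n M1 M2 x1 x2 \<le> 4 * e"
proof -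
  obtain x1 x2 where x: "1 / (real M1 * real M2) * (\<Sum>i<M1. \<Sum>j<M2. measure_pmf.prob (seq_channel K n (x1 i) (x2 i j))
      {w. \<exists>i'<M1. \<exists>j'<M2. (i', j') \<noteq> (i, j) \<and> score (x1 i') (x2 i' j') w \<ge> score (x1 i) (x2 i j) w})
    \<le> 4 * e"
    using random_code_exists[of M1 M2 e p1 p2 "seq_channel K n" typical score]
      M e prob_not_typical same_cloud other_cloud unfolding joint_law_def by force
  have "{y. \<not> decodes_correctly q n M1 M2 x1 x2 i j y}
    = {w. \<exists>i'<M1. \<exists>j'<M2. (i', j') \<noteq> (i, j) \<and> score (x1 i') (x2 i' j') w \<ge> score (x1 i) (x2 i j) w}" for i j
    unfolding decodes_correctly_def metric_score_def score_def by (force simp: not_less)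
  then have "avg_error W q n M1 M2 x1 x2 \<le> 4 * e"
    using x unfolding avg_error_msg_error msg_error_prob[OF K] by simp
  then show ?thesis by blast
qed

end

end

section \<open>Asymptotics and choice of constants\<close>

lemma num_msgs_minus_one_le: "real (num_msgs n (max 0 R) - 1) \<le> 2 powr (real n * R)"
proof (cases "R \<le> 0")
  \<comment> \<open>A nonpositive rate is truncated to a single message, which has no competitors at
    all; so \<open>R1 - d\<close> and \<open>R2 - d\<close> may be negative in the
    exponents.\<close>
  case True
  then show ?thesis by (simp add: num_msgs_def)
next
  case False
  have "real (num_msgs n R) < 2 powr (real n * R) + 1"
    unfolding num_msgs_def using powr_gt_zero[of 2 "real n * R"] by linarith
  then have "real (num_msgs n R - 1) \<le> 2 powr (real n * R)"
    using num_msgs_pos[of n R] by (simp add: of_nat_diff)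
  with False show ?thesis by (simp add: max_def)
qed

text \<open>A competing cloud contributes all its satellites, none being the transmitted one;
  rounding up then costs a factor 2.\<close>

lemma num_msgs_le_double:
  assumes "0 \<le> R"
  shows "real (num_msgs n R) \<le> 2 * 2 powr (real n * R)"
proof -
  have "1 \<le> 2 powr (real n * R)"
    using assms by (intro ge_one_powr_ge_zero) auto
  then show ?thesis unfolding num_msgs_def by linarith
qed

lemma exp_decay_tendsto:
  fixes r :: real
  assumes "0 < r"
  shows "(\<lambda>n. c * (2 * exp (- 2 * real n * r))) \<longlonglongrightarrow> 0"
  using assms by real_asymp

lemma poly_times_decay_tendsto:
  fixes r :: real
  assumes "0 < r"
  shows "(\<lambda>n. real (n + 1) ^ k * (8 * 2 powr (- real n * r))) \<longlonglongrightarrow> 0"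
  using assms by real_asymp

lemma ensemble_pmfs:
  assumes p: "is_dist2 p"
  shows "\<exists>P1 P21. \<forall>a b. pmf P1 a * pmf (P21 a) b = p a b"
proof -
  have nn: "0 \<le> p a b" for a b using p by (simp add: is_dist2_def)
  have "\<exists>P1. \<forall>a. pmf P1 a = (\<Sum>b\<in>UNIV. p a b)"
    using p by (intro ex_pmf_of_fun) (auto simp: is_dist2_def intro: sum_nonneg)
  moreover have "\<forall>a. \<exists>Q. \<forall>b. (\<Sum>b\<in>UNIV. p a b) * pmf Q b = p a b"
    using nn by (intro allI ex_pmf_proportional)
  ultimately show ?thesis by metis
qed

text \<open>The alternatives of \<open>L0_slack\<close> make either the cloud centre or the whole codeword pair too
  unlikely; \<open>R1 - d\<close> and \<open>R2 - d\<close> lose twice as much rate as the slack \<open>d / 2\<close> costs.\<close>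

lemma cloud_exponent_bound:
  assumes R: "0 \<le> R1" "0 \<le> R2" and d: "0 < d"
    and alt: "R1 - d / 2 \<le> I1 \<or> R1 + R2 - d / 2 \<le> I12"
  shows "real (num_msgs n (max 0 (R1 - d)) - 1) *
      min (2 * 2 powr (- real n * I1)) (4 * real (num_msgs n (max 0 (R2 - d))) * 2 powr (- real n * I12))
    \<le> 8 * 2 powr (- real n * (d / 2))"
proof -
  let ?L = "real (num_msgs n (max 0 (R1 - d)) - 1)" and ?M = "real (num_msgs n (max 0 (R2 - d)))"
  have L: "?L \<le> 2 powr (real n * (R1 - d))" by (rule num_msgs_minus_one_le)
  from alt show ?thesis
  proof
    assume I: "R1 - d / 2 \<le> I1"
    have "?L * min (2 * 2 powr (- real n * I1)) (4 * ?M * 2 powr (- real n * I12))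
        \<le> 2 powr (real n * (R1 - d)) * (2 * 2 powr (- real n * I1))"
      by (intro mult_mono L) auto
    also have "\<dots> = 2 * 2 powr (real n * (R1 - d) - real n * I1)"
      by (simp add: powr_add[symmetric])
    also have "\<dots> \<le> 2 * 2 powr (- real n * (d / 2))"
      using mult_left_mono[OF I, of "real n"] by (simp add: algebra_simps)
    also have "\<dots> \<le> 8 * 2 powr (- real n * (d / 2))" by simp
    finally show ?thesis .
  next
    assume I: "R1 + R2 - d / 2 \<le> I12"
    have "?M \<le> 2 * 2 powr (real n * max 0 (R2 - d))"
      by (rule num_msgs_le_double) simp
    \<comment> \<open>Raising the rate to \<open>R2\<close> also covers \<open>R2 < d\<close>; the
      loss \<open>d\<close> in the first rate alone already outweighs the slack
      \<open>d / 2\<close>.\<close>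
    also have "\<dots> \<le> 2 * 2 powr (real n * R2)"
      using R d by (auto intro!: mult_left_mono)
    finally have M: "?M \<le> 2 * 2 powr (real n * R2)" .
    have "?L * min (2 * 2 powr (- real n * I1)) (4 * ?M * 2 powr (- real n * I12))
        \<le> 2 powr (real n * (R1 - d)) * (4 * (2 * 2 powr (real n * R2)) * 2 powr (- real n * I12))"
      by (intro mult_mono L min.coboundedI2 M) auto
    also have "\<dots> = 8 * 2 powr (real n * (R1 - d) + real n * R2 - real n * I12)"
      by (simp add: powr_add powr_diff powr_minus field_simps)
    also have "\<dots> \<le> 8 * 2 powr (- real n * (d / 2))"
      using mult_left_mono[OF I, of "real n"] by (simp add: algebra_simps)
    finally show ?thesis .
  qed
qed

lemma R_cog_sup_achievable:
  fixes W q :: "'a::finite \<Rightarrow> 'b::finite \<Rightarrow> 'c::finite \<Rightarrow> real"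
  assumes W: "is_channel W" and p: "is_dist2 p"
    and R: "(R1, R2) \<in> R_cog_sup q (\<lambda>a b c. p a b * W a b c)" and d: "0 < d"
  shows "achievable W q (max 0 (R1 - d), max 0 (R2 - d))"
proof -
  let ?P = "\<lambda>a b c. p a b * W a b c"
  obtain K where K: "\<And>a b c. pmf (K a b) c = W a b c" using is_channel_pmf[OF W] by blast
  obtain P1 P21 where P12: "\<And>a b. pmf P1 a * pmf (P21 a) b = p a b" using ensemble_pmfs[OF p] by blast
  have R0: "0 \<le> R1" "0 \<le> R2" using R by (auto simp: R_cog_sup_def)
  obtain \<eta>2 where \<eta>2: "0 < \<eta>2" "\<And>f. is_dist3 f \<Longrightarrow> dev12 ?P f \<le> \<eta>2 \<Longrightarrow> dev1Y ?P f \<le> \<eta>2 \<Longrightarrow>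
      expect_q f q \<ge> expect_q ?P q - \<eta>2 \<Longrightarrow> R2 - d / 2 \<le> MI_X2_Y_given_X1 f"
    using L2_slack[of q ?P R2 "d / 2"] R d by (auto simp: R_cog_sup_def)
  obtain \<eta>0 where \<eta>0: "0 < \<eta>0" "\<And>f. is_dist3 f \<Longrightarrow> dev12 ?P f \<le> \<eta>0 \<Longrightarrow> devY ?P f \<le> \<eta>0 \<Longrightarrow>
      expect_q f q \<ge> expect_q ?P q - \<eta>0 \<Longrightarrow> R1 - d / 2 \<le> MI_X1_Y f \<or> R1 + R2 - d / 2 \<le> MI_X1X2_Y f"
    using L0_slack[of q ?P R1 "R1 + R2" "d / 2"] R d by (auto simp: R_cog_sup_def)
  define \<eta> where "\<eta> = min \<eta>0 \<eta>2"
  have \<eta>: "0 < \<eta>" "\<eta> \<le> \<eta>0" "\<eta> \<le> \<eta>2" using \<eta>0(1) \<eta>2(1) by (auto simp: \<eta>_def)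
  define C where "C = (\<Sum>a\<in>UNIV. \<Sum>b\<in>UNIV. \<Sum>c\<in>UNIV. 1 + \<bar>q a b c\<bar>)"
  have "C > 0" unfolding C_def by (rule sum_one_plus_abs_pos)
  then have r: "0 < (\<eta> / C)\<^sup>2" using \<eta>(1) by simp
  define k where "k = CARD('a \<times> 'b \<times> 'c)"
  define e0 where "e0 n = real k * (2 * exp (- 2 * real n * (\<eta> / C)\<^sup>2))" for n :: nat
  \<comment> \<open>The constant 8 comes from the competing clouds, 4 from conditioning times 2 from
    rounding, and also covers the 2 of the same-cloud bound.\<close>
  define g where "g n = real (n + 1) ^ k * (8 * 2 powr (- real n * (d / 2)))" for n :: nat
  have e0_lim: "e0 \<longlonglongrightarrow> 0" unfolding e0_def by (rule exp_decay_tendsto[OF r])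
  have g_lim: "g \<longlonglongrightarrow> 0" unfolding g_def using d by (intro poly_times_decay_tendsto) simp
  show ?thesis
    unfolding achievable_def
  proof (intro conjI allI impI)
    fix \<epsilon> :: real assume \<epsilon>: "0 < \<epsilon>"
    \<comment> \<open>The code is built with \<open>e = \<epsilon> / 4\<close>, giving error at most
      \<open>4 * e\<close>, and needs \<open>4 * e0 n \<le> e\<close>, hence
      \<open>\<epsilon> / 16\<close>. The bound 1/4 makes the conditioning legitimate.\<close>
    have "eventually (\<lambda>n. e0 n < min (\<epsilon> / 16) (1 / 4)) sequentially"
      using \<epsilon> by (intro order_tendstoD(2)[OF e0_lim]) auto
    moreover have "eventually (\<lambda>n. g n < \<epsilon> / 4) sequentially"
      using \<epsilon> by (intro order_tendstoD(2)[OF g_lim]) auto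
    ultimately have "eventually (\<lambda>n. e0 n < min (\<epsilon> / 16) (1 / 4) \<and> g n < \<epsilon> / 4 \<and> 0 < n) sequentially"
      using eventually_gt_at_top[of "0 :: nat"] by eventually_elim auto
    then obtain N where N: "\<And>n. n \<ge> N \<Longrightarrow> e0 n < min (\<epsilon> / 16) (1 / 4) \<and> g n < \<epsilon> / 4 \<and> 0 < n"
      unfolding eventually_sequentially by blast
    show "\<exists>N. \<forall>n\<ge>N. \<exists>x1 x2. avg_error W q n (num_msgs n (fst (max 0 (R1 - d), max 0 (R2 - d))))
        (num_msgs n (snd (max 0 (R1 - d), max 0 (R2 - d)))) x1 x2 \<le> \<epsilon>"
    proof (rule exI[of _ N], intro allI impI)
      fix n assume "N \<le> n"
      then have nb: "e0 n \<le> \<epsilon> / 16" "e0 n \<le> 1 / 4" "g n \<le> \<epsilon> / 4" "0 < n"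
        using N[of n] by auto
      interpret superposition_ensemble W q p K P1 P21 n \<eta>
        by unfold_locales (use K P12 nb in auto)
      let ?M1 = "num_msgs n (max 0 (R1 - d))" and ?M2 = "num_msgs n (max 0 (R2 - d))"
      have atyp: "measure_pmf.prob (joint_law Q1 Q2) {(u, v, w). \<not> typical u v w} \<le> e0 n"
        using prob_not_typical_iid[OF \<eta>(1)] unfolding e0_def k_def C_def .
      have "\<exists>x1 x2. avg_error W q n ?M1 ?M2 x1 x2 \<le> 4 * (\<epsilon> / 4)"
      proof (rule code_exists[OF atyp nb(2) num_msgs_pos num_msgs_pos])
        fix u v w assume uvw: "u \<in> set_pmf p1" "typical u v w"
        have "measure_pmf.prob (p2 u) {v'. score u v' w \<ge> score u v w}
            \<le> real (n + 1) ^ k * (2 * 2 powr (- real n * (R2 - d / 2)))"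
          unfolding k_def
          by (rule prob_same_cloud_le[OF atyp nb(2) uvw]) (use \<eta> \<eta>2(2) in \<open>force simp: P_def\<close>)
        then have "real (?M2 - 1) * measure_pmf.prob (p2 u) {v'. score u v' w \<ge> score u v w}
            \<le> 2 powr (real n * (R2 - d)) * (real (n + 1) ^ k * (2 * 2 powr (- real n * (R2 - d / 2))))"
          by (intro mult_mono num_msgs_minus_one_le) auto
        also have "\<dots> = real (n + 1) ^ k * (2 * 2 powr (real n * (R2 - d) + - real n * (R2 - d / 2)))"
          by (simp only: powr_add mult_ac)
        also have "real n * (R2 - d) + - real n * (R2 - d / 2) = - real n * (d / 2)"
          by (simp add: algebra_simps)
        also have "real (n + 1) ^ k * (2 * 2 powr (- real n * (d / 2))) \<le> g n"
          unfolding g_def by (intro mult_left_mono) auto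
        finally show "real (?M2 - 1) * measure_pmf.prob (p2 u) {v'. score u v' w \<ge> score u v w} \<le> \<epsilon> / 4"
          using nb(3) by simp
      next
        fix u v w assume uvw: "typical u v w"
        have "real (?M1 - 1) * measure_pmf.prob (cloud_pmf p1 p2 ?M2)
            {(u', V). \<exists>j<?M2. score u' (V j) w \<ge> score u v w} \<le> g n"
          unfolding g_def k_def
        proof (rule prob_other_cloud_le[OF atyp nb(2) uvw])
          fix f assume "is_dist3 f" "dev12 P f \<le> \<eta>" "devY P f \<le> \<eta>" "expect_q P q - \<eta> \<le> expect_q f q"
          then have "R1 - d / 2 \<le> MI_X1_Y f \<or> R1 + R2 - d / 2 \<le> MI_X1X2_Y f"
            using \<eta> by (intro \<eta>0(2)) (auto simp: P_def)
          then show "real (?M1 - 1) * min (2 * 2 powr (- real n * MI_X1_Y f))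
              (4 * real ?M2 * 2 powr (- real n * MI_X1X2_Y f)) \<le> 8 * 2 powr (- real n * (d / 2))"
            by (rule cloud_exponent_bound[OF R0 d])
        qed simp
        then show "real (?M1 - 1) * measure_pmf.prob (cloud_pmf p1 p2 ?M2)
            {(u', V). \<exists>j<?M2. score u' (V j) w \<ge> score u v w} \<le> \<epsilon> / 4"
          using nb(3) by simp
      qed (use \<epsilon> nb in auto)
      then show "\<exists>x1 x2. avg_error W q n (num_msgs n (fst (max 0 (R1 - d), max 0 (R2 - d))))
        (num_msgs n (snd (max 0 (R1 - d), max 0 (R2 - d)))) x1 x2 \<le> \<epsilon>" by simp
    qed
  qed auto
qed

theorem theorem3:
  fixes W :: "'a::finite \<Rightarrow> 'b::finite \<Rightarrow> 'c::finite \<Rightarrow> real"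
    and q :: "'a \<Rightarrow> 'b \<Rightarrow> 'c \<Rightarrow> real"
  assumes "is_channel W"
  shows "closure (convex hull (\<Union>P\<in>induced_dists W. R_cog_sup q P)) \<subseteq> capacity_region W q"
  unfolding capacity_region_def
proof (intro closure_minimal hull_minimal)
  \<comment> \<open>The target is closed and convex, so it is enough to place each single region
    inside it, pair by pair.\<close>
  show "(\<Union>P\<in>induced_dists W. R_cog_sup q P) \<subseteq> closure {R. achievable W q R}"
  proof clarify
    fix P R1 R2 assume "P \<in> induced_dists W" and R: "(R1, R2) \<in> R_cog_sup q P"
    then obtain p where p: "is_dist2 p" "P = (\<lambda>a b c. p a b * W a b c)"
      by (auto simp: induced_dists_def)
    have "0 \<le> R1" "0 \<le> R2" using R by (auto simp: R_cog_sup_def)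
    then show "(R1, R2) \<in> closure {R. achievable W q R}"
      using R_cog_sup_achievable[OF assms p(1) R[unfolded p(2)]] by (intro closure_achievable) auto
  qed
  show "convex (closure {R. achievable W q R})"
    by (rule convex_closure_achievable[OF assms])
qed auto

end
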